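(* Let $d\in\{2,3\}$ and let $\Omega$ be a bounded simply connected domain in $\mathbb{R}^d$ with $C^1$ boundary. Suppose that $\sigma_m$ is anisotropic (a constant symmetric positive definite $d\times d$ matrix) and that $\sigma_m-\sigma_c I$ is either positive-definite or negative-definite, where $\sigma_c>0$ is a scalar constant. Then $\Omega$ with a certain interface parameter $\beta$ is neutral to all uniform fields if and only if $\Omega$ is an ellipse if $d=2$ and an ellipsoid if $d=3$. If $\sigma_m$ is isotropic (a scalar multiple of the identity) and $\Omega$ with a certain interface parameter $\beta$ is neutral to all uniform fields, then $\Omega$ must be a disk (if $d=2$) or a ball (if $d=3$).
   Context: An interface parameter is a non-negative function $\beta$ on $\partial\Omega$. Let $\sigma=\sigma_c\chi(\Omega)+\sigma_m\chi(\mathbb{R}^d\setminus\overline{\Omega})$, where $\chi$ denotes the characteristic function. For a unit vector $a\in\mathbb{R}^d$, consider the low-conductivity type imperfect interface problem $$\begin{cases}\nabla\cdot\sigma\nabla u=0 & \text{in }\Omega\cup(\mathbb{R}^d\setminus\overline{\Omega}),\\ \beta(u|_+-u|_-)=\sigma_m\dfrac{\partial u}{\partial\nu}\Big|_+ & \text{on }\partial\Omega,\\ \sigma_c\dfrac{\partial u}{\partial\nu}\Big|_-=\sigma_m\dfrac{\partial u}{\partial\nu}\Big|_+ & \text{on }\partial\Omega,\\ u(x)-a\cdot x=O(|x|^{1-d}) & \text{as }|x|\to\infty,\end{cases}$$ where $\nu$ is the outward unit normal, the subscripts $+$ and $-$ denote the limits to $\partial\Omega$ from outside and inside $\Omega$,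 and for a matrix $\sigma_m$ the expression $\sigma_m\frac{\partial u}{\partial\nu}$ means the conormal derivative $\nu\cdot\sigma_m\nabla u$. The inclusion $\Omega$ with interface parameter $\beta$ is neutral to the uniform field $a$ if the solution $u$ satisfies $u(x)-a\cdot x\equiv 0$ for all $x\in\mathbb{R}^d\setminus\Omega$; it is neutral to all uniform fields if this holds for every unit vector $a$.
   Formalization: The "if" part fails for fixed σ_c, σ_m (e.g. unit disk, σ_c=3, σ_m=diag(1,2)); proved instead: neutral for some β iff Ω is an ellipse/ellipsoid {(x−c)·(σ_cσ_m⁻¹−I)(x−c)<r²}, and every ellipse/ellipsoid is neutral for some suitable σ_m and β. *)

theory Defs
  imports "HOL-Analysis.Analysis" "HOL-Library.Landau_Symbols"
begin

definition pos_def :: "real^'d^'d \<Rightarrow> bool" where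
  "pos_def A \<longleftrightarrow> transpose A = A \<and> (\<forall>x. x \<noteq> 0 \<longrightarrow> 0 < x \<bullet> (A *v x))"

definition neg_def :: "real^'d^'d \<Rightarrow> bool" where
  "neg_def A \<longleftrightarrow> pos_def (- A)"

definition grad :: "(real^'d \<Rightarrow> real) \<Rightarrow> real^'d \<Rightarrow> real^'d" where
  "grad u x = (\<chi> i. frechet_derivative u (at x) (axis i 1))"

definition divergence :: "(real^'d \<Rightarrow> real^'d) \<Rightarrow> real^'d \<Rightarrow> real" where
  "divergence F x = trace (jacobian F (at x))"

definition C2_on :: "(real^'d) set \<Rightarrow> (real^'d \<Rightarrow> real) \<Rightarrow> bool" where
  "C2_on S u \<longleftrightarrow>
     (\<forall>x\<in>S. u differentiable (at x) \<and> grad u differentiable (at x)) \<and>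
     continuous_on S (\<lambda>x. jacobian (grad u) (at x))"

text \<open>
  A set has \<open>C\<^sup>1\<close> boundary if near each boundary point it is the set where some
  \<open>C\<^sup>1\<close> function with non-vanishing gradient is negative, so that it lies on one side of
  its boundary. The outward normal is the normalised gradient of any such function.
\<close>

definition C1_defining_function ::
    "(real^'d) set \<Rightarrow> real^'d \<Rightarrow> (real^'d) set \<Rightarrow> (real^'d \<Rightarrow> real) \<Rightarrow> bool" where
  "C1_defining_function \<Omega> p U \<rho> \<longleftrightarrow>
     open U \<and> p \<in> U \<and>
     (\<forall>x\<in>U. \<rho> differentiable (at x) \<and> grad \<rho> x \<noteq> 0) \<and> continuous_on U (grad \<rho>) \<and>
     \<Omega> \<inter> U = {x \<in> U. \<rho> x < 0}"

definition C1_boundary :: "(real^'d) set \<Rightarrow> bool" where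
  "C1_boundary \<Omega> \<longleftrightarrow> (\<forall>p\<in>frontier \<Omega>. \<exists>U \<rho>. C1_defining_function \<Omega> p U \<rho>)"

definition outward_normal :: "(real^'d) set \<Rightarrow> real^'d \<Rightarrow> real^'d" where
  "outward_normal \<Omega> p =
     (THE n. \<exists>U \<rho>. C1_defining_function \<Omega> p U \<rho> \<and> n = grad \<rho> p /\<^sub>R norm (grad \<rho> p))"

definition interface_parameter :: "(real^'d) set \<Rightarrow> (real^'d \<Rightarrow> real) \<Rightarrow> bool" where
  "interface_parameter \<Omega> \<beta> \<longleftrightarrow> (\<forall>x\<in>frontier \<Omega>. 0 \<le> \<beta> x)"

text \<open>\<open>mat k\<close> is \<open>k\<close> times the identity matrix.\<close>

definition conductivity ::
    "(real^'d) set \<Rightarrow> real \<Rightarrow> real^'d^'d \<Rightarrow> real^'d \<Rightarrow> real^'d^'d" where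
  "conductivity \<Omega> \<sigma>c \<sigma>m x =
     indicat_real \<Omega> x *\<^sub>R mat \<sigma>c + indicat_real (- closure \<Omega>) x *\<^sub>R \<sigma>m"

text \<open>
  Classical solutions of the low-conductivity type problem: \<open>u\<close> is \<open>C\<^sup>2\<close> off the
  interface, and \<open>u\<close> and its gradient have limits \<open>up, gp\<close> from outside and \<open>um, gm\<close> from
  inside at each interface point. The values of \<open>u\<close> on the interface itself play no role.
\<close>

definition imperfect_interface_solution ::
    "(real^'d) set \<Rightarrow> real \<Rightarrow> real^'d^'d \<Rightarrow> (real^'d \<Rightarrow> real) \<Rightarrow> real^'d \<Rightarrow>
     (real^'d \<Rightarrow> real) \<Rightarrow> bool" where
  "imperfect_interface_solution \<Omega> \<sigma>c \<sigma>m \<beta> a u \<longleftrightarrow>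
     C2_on (\<Omega> \<union> - closure \<Omega>) u \<and>
     (\<forall>x \<in> \<Omega> \<union> - closure \<Omega>. divergence (\<lambda>y. conductivity \<Omega> \<sigma>c \<sigma>m y *v grad u y) x = 0) \<and>
     (\<forall>x \<in> frontier \<Omega>. \<exists>up um gp gm.
        (u \<longlongrightarrow> up) (at x within - closure \<Omega>) \<and> (u \<longlongrightarrow> um) (at x within \<Omega>) \<and>
        (grad u \<longlongrightarrow> gp) (at x within - closure \<Omega>) \<and> (grad u \<longlongrightarrow> gm) (at x within \<Omega>) \<and>
        \<beta> x * (up - um) = outward_normal \<Omega> x \<bullet> (\<sigma>m *v gp) \<and>
        \<sigma>c * (outward_normal \<Omega> x \<bullet> gm) = outward_normal \<Omega> x \<bullet> (\<sigma>m *v gp)) \<and>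
     (\<lambda>x. u x - a \<bullet> x) \<in> O[at_infinity](\<lambda>x. norm x powr (1 - real CARD('d)))"

definition neutral_to ::
    "(real^'d) set \<Rightarrow> real \<Rightarrow> real^'d^'d \<Rightarrow> (real^'d \<Rightarrow> real) \<Rightarrow> real^'d \<Rightarrow> bool" where
  "neutral_to \<Omega> \<sigma>c \<sigma>m \<beta> a \<longleftrightarrow>
     (\<exists>u. imperfect_interface_solution \<Omega> \<sigma>c \<sigma>m \<beta> a u \<and> (\<forall>x \<in> - \<Omega>. u x - a \<bullet> x = 0))"

definition neutral_to_all ::
    "(real^'d) set \<Rightarrow> real \<Rightarrow> real^'d^'d \<Rightarrow> (real^'d \<Rightarrow> real) \<Rightarrow> bool" where
  "neutral_to_all \<Omega> \<sigma>c \<sigma>m \<beta> \<longleftrightarrow> (\<forall>a. norm a = 1 \<longrightarrow> neutral_to \<Omega> \<sigma>c \<sigma>m \<beta> a)"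

text \<open>Open solid ellipsoids (ellipses in the plane), in any position; balls are included.\<close>

definition is_ellipsoid :: "(real^'d) set \<Rightarrow> bool" where
  "is_ellipsoid E \<longleftrightarrow> (\<exists>c Q. pos_def Q \<and> E = {x. (x - c) \<bullet> (Q *v (x - c)) < 1})"

text \<open>
  For fixed conductivities the field inside a neutral inclusion is affine, and the jump condition
  then makes \<open>\<nu>\<close> a non-negative multiple of \<open>(\<sigma>c \<sigma>m\<inverse> - I)(x - c)\<close>. The conductivities
  thus prescribe the directions of the axes and the ratios of their lengths, which is expressed here.
\<close>

definition axes_compatible :: "real \<Rightarrow> real^'d^'d \<Rightarrow> (real^'d) set \<Rightarrow> bool" where
  "axes_compatible \<sigma>c \<sigma>m E \<longleftrightarrow>
     (\<exists>c r. 0 < r \<and>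
        E = {x. (x - c) \<bullet> ((\<sigma>c *\<^sub>R matrix_inv \<sigma>m - mat 1) *v (x - c)) < r\<^sup>2})"

end

theory Submission
  imports Defs
begin

text \<open>
  Outside a neutral inclusion the solution is the uniform field \<open>a \<bullet> x\<close>, so its flux through the
  interface is \<open>\<nu> \<bullet> (\<sigma>m *v a)\<close>. Inside, the solution is harmonic with this prescribed
  flux. The linear function with gradient \<open>(\<sigma>m *v a) / \<sigma>c\<close> is harmonic with the same
  flux, and the Neumann problem on a bounded connected \<open>C\<^sup>1\<close> domain determines its solution up to a
  constant (\<open>neumann_constant\<close>). The inner field is therefore affine, and the jump condition for
  all directions \<open>a\<close> together says that
  \<open>\<nu> = (\<beta> / \<sigma>c) (B x - b)\<close> on the interface, with the symmetric matrix
  \<open>B = \<sigma>c \<sigma>m\<inverse> - I\<close> and some vector \<open>b\<close> (\<open>neutral_normal_field\<close>).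

  The rest is geometry. Consider \<open>\<psi> x = x \<bullet> B x / 2 - b \<bullet> x\<close>, whose gradient is
  \<open>B x - b\<close>. At a boundary minimum over the closure this gradient would point against \<open>\<nu>\<close>,
  whereas \<open>\<beta> \<ge> 0\<close> makes it point along \<open>\<nu>\<close>. The minimum is thus attained at some
  \<open>c\<close> inside; there \<open>B c = b\<close>, and \<open>B\<close> is positive semidefinite because \<open>\<psi>\<close> is
  quadratic with an interior minimum (\<open>affine_normal_field_centre\<close>). For a definite contrast \<open>B\<close>
  is injective, hence positive definite. With the norm of \<open>B\<close>, the normal at each interface point is
  radial as seen from \<open>c\<close>. A point of the complement that is nearest to a centre
  \<open>c + \<epsilon> w\<close> then has to lie on the line through \<open>c\<close> and \<open>c + \<epsilon> w\<close>, and letting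
  \<open>\<epsilon>\<close> tend to \<open>0\<close> shows that the whole level set of \<open>(x - c) \<bullet> B (x - c)\<close> through a
  nearest point of the complement lies in the complement; connectedness leaves only the sublevel set
  (\<open>radial_normal_field_ellipsoid\<close>). A scalar \<open>\<sigma>m\<close> makes \<open>B\<close> scalar and the ellipsoid a ball.

  Conversely, on the ellipsoid given by \<open>B\<close> the normal is \<open>B (x - c) / |B (x - c)|\<close>, so with
  \<open>\<beta> = \<sigma>c / |B (x - c)|\<close> the piecewise affine function read off from the argument above solves
  the problem (\<open>ellipsoid_neutral_solution\<close>). Every ellipsoid arises in this way, from
  \<open>\<sigma>m = \<sigma>c (I + Q)\<inverse>\<close>.

  Uniqueness for the Neumann problem is obtained from the identity \<open>\<integral> |\<nabla>w|\<^sup>2 = 0\<close>. On a boundary that is only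
  \<open>C\<^sup>1\<close> it is proved by cutting off: near a boundary point with defining function \<open>\<rho>\<close>, the field
  \<open>\<phi> \<nabla>w\<close> is multiplied by a step function of \<open>\<rho> / \<delta>\<close>. The gradient of the cutoff has
  size \<open>1 / \<delta>\<close> and lives on a layer of volume \<open>O(\<delta>)\<close>, but it is parallel to
  \<open>\<nabla>\<rho>\<close>, and \<open>\<nabla>w \<bullet> \<nabla>\<rho>\<close> is uniformly small on that layer (\<open>local_green\<close>).
\<close>

section \<open>Gradients and outward normals\<close>

lemma has_derivative_grad:
  fixes u :: "real^'d \<Rightarrow> real"
  assumes "u differentiable (at x)"
  shows "(u has_derivative (\<lambda>h. grad u x \<bullet> h)) (at x)"
proof -
  define D where "D = frechet_derivative u (at x)"
  have D: "(u has_derivative D) (at x)"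
    using assms unfolding D_def by (simp add: frechet_derivative_works)
  then interpret linear D by (rule has_derivative_linear)
  have "D h = grad u x \<bullet> h" for h
  proof -
    have "D h = D (\<Sum>i\<in>UNIV. (h $ i) *\<^sub>R axis i 1)"
      by (simp add: basis_expansion flip: scalar_mult_eq_scaleR)
    also have "\<dots> = (\<Sum>i\<in>UNIV. h $ i * D (axis i 1))" by (simp add: sum scale)
    also have "\<dots> = grad u x \<bullet> h" by (simp add: inner_vec_def grad_def D_def mult.commute)
    finally show ?thesis .
  qed
  then have "D = (\<lambda>h. grad u x \<bullet> h)" by auto
  with D show ?thesis by simp
qed

lemma grad_unique:
  fixes u :: "real^'d \<Rightarrow> real"
  assumes "(u has_derivative (\<lambda>h. g \<bullet> h)) (at x)"
  shows "grad u x = g"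
proof -
  have "frechet_derivative u (at x) = (\<lambda>h. g \<bullet> h)"
    using frechet_derivative_at[OF assms] by (rule sym)
  then show ?thesis by (simp add: grad_def vec_eq_iff inner_axis)
qed

text \<open>
  If the half space of directions decreasing along \<open>n\<close> contains no direction increasing along
  \<open>g\<close>, then \<open>g\<close> has no component orthogonal to \<open>n\<close>. This is how extrema at a boundary point
  yield gradients parallel to the normal.
\<close>

lemma half_space_multiple:
  fixes n g :: "'a::real_inner"
  assumes "n \<noteq> 0" and "\<And>v. n \<bullet> v < 0 \<Longrightarrow> g \<bullet> v \<le> 0"
  shows "\<exists>k\<ge>0. g = k *\<^sub>R n"
proof -
  \<comment> \<open>\<open>t\<close> is the part of \<open>g\<close> orthogonal to \<open>n\<close>; the directions \<open>t - e n\<close> are admissible for every \<open>e > 0\<close>.\<close>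
  define k where "k = (g \<bullet> n) / (n \<bullet> n)"
  define t where "t = g - k *\<^sub>R n"
  have nn: "n \<bullet> n > 0" using assms by simp
  have nt: "n \<bullet> t = 0" using nn by (simp add: t_def k_def inner_diff_right inner_commute)
  have gt: "g \<bullet> t = t \<bullet> t" using nt by (simp add: t_def inner_diff_left)
  have *: "t \<bullet> t \<le> e * (g \<bullet> n)" if "e > 0" for e
  proof -
    have "n \<bullet> (t - e *\<^sub>R n) < 0" using nt nn that by (simp add: inner_diff_right)
    from assms(2)[OF this] show ?thesis using gt by (simp add: inner_diff_right)
  qed
  have "t = 0"
  proof (rule ccontr)
    assume "t \<noteq> 0"
    then have tt: "t \<bullet> t > 0" by simp
    have "g \<bullet> n > 0" using *[of 1] tt by linarith
    then show False using *[of "(t \<bullet> t) / (2 * (g \<bullet> n))"] tt by simp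
  qed
  then have "g = k *\<^sub>R n" by (simp add: t_def)
  moreover have "k \<ge> 0"
    using assms(2)[of "- n"] nn by (simp add: k_def)
  ultimately show ?thesis by blast
qed

lemma C1_defining_functionD:
  assumes "C1_defining_function \<Omega> p U \<rho>"
  shows "open U" "p \<in> U" "\<And>x. x \<in> U \<Longrightarrow> \<rho> differentiable (at x)"
    "\<And>x. x \<in> U \<Longrightarrow> grad \<rho> x \<noteq> 0" "continuous_on U (grad \<rho>)"
    "\<And>x. x \<in> U \<Longrightarrow> x \<in> \<Omega> \<longleftrightarrow> \<rho> x < 0" "continuous_on U \<rho>"
proof -
  show "continuous_on U \<rho>"
    using assms unfolding C1_defining_function_def
    by (meson continuous_at_imp_continuous_on differentiable_imp_continuous_within)
qed (use assms in \<open>unfold C1_defining_function_def; blast\<close>)+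

lemma defining_function_zero:
  assumes "C1_defining_function \<Omega> p U \<rho>" "open \<Omega>" "x \<in> U" "x \<in> frontier \<Omega>"
  shows "\<rho> x = 0"
proof (rule antisym)
  note D = C1_defining_functionD[OF assms(1)]
  have "x \<notin> \<Omega>" using assms by (simp add: frontier_def interior_open)
  then show "0 \<le> \<rho> x" using D(6)[OF assms(3)] by simp
  show "\<rho> x \<le> 0"
  proof (rule ccontr)
    assume "\<not> \<rho> x \<le> 0"
    then have "x \<in> {y\<in>U. \<rho> y > 0}" using assms by simp
    moreover have "open {y\<in>U. \<rho> y > 0}"
      using continuous_open_preimage[OF D(7) D(1) open_greaterThan[of 0]]
      by (simp add: vimage_def Int_def)
    moreover have "x \<in> closure \<Omega>" using assms by (simp add: frontier_def)
    ultimately obtain y where "y \<in> \<Omega>" "y \<in> U" "\<rho> y > 0"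
      by (metis (no_types, lifting) closure_iff_nhds_not_empty disjoint_iff mem_Collect_eq subset_refl)
    with D(6) show False by force
  qed
qed

lemma directional_increase:
  fixes g :: "real^'d \<Rightarrow> real"
  assumes "(g has_derivative (\<lambda>h. n \<bullet> h)) (at p)" "n \<bullet> v > 0"
  shows "\<forall>\<^sub>F s in at_right 0. g (p + s *\<^sub>R v) > g p"
proof -
  have "((\<lambda>s::real. g (p + s *\<^sub>R v)) has_derivative (\<lambda>s. n \<bullet> (s *\<^sub>R v))) (at 0)"
    by (rule has_derivative_compose[of "\<lambda>s. p + s *\<^sub>R v" "\<lambda>s. s *\<^sub>R v" 0 UNIV g "\<lambda>h. n \<bullet> h"])
       (use assms in \<open>auto intro!: derivative_eq_intros\<close>)
  then have "((\<lambda>s::real. g (p + s *\<^sub>R v)) has_real_derivative (n \<bullet> v)) (at 0)"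
    unfolding has_field_derivative_def by (simp add: mult_commute_abs)
  from DERIV_pos_inc_right[OF this assms(2)] obtain d where
    "d > 0" "\<And>h. h > 0 \<Longrightarrow> h < d \<Longrightarrow> g (p + h *\<^sub>R v) > g p" by auto
  then show ?thesis unfolding eventually_at_right_field by (metis add_0)
qed

lemma eventually_in_open_right:
  assumes "open U" "p \<in> U"
  shows "\<forall>\<^sub>F s in at_right 0. p + s *\<^sub>R (v::'a::real_normed_vector) \<in> U"
proof -
  have "((\<lambda>s. p + s *\<^sub>R v) \<longlongrightarrow> p + 0 *\<^sub>R v) (at_right 0)"
    by (intro tendsto_intros)
  then show ?thesis using assms topological_tendstoD by fastforce
qed

lemma interior_minimum:
  fixes \<psi> :: "real^'d \<Rightarrow> real"
  assumes "open S" "p \<in> S" "(\<psi> has_derivative (\<lambda>h. g \<bullet> h)) (at p)"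
    and "\<And>x. x \<in> S \<Longrightarrow> \<psi> p \<le> \<psi> x"
  shows "g = 0"
proof (rule ccontr)
  assume "g \<noteq> 0"
  then have "(- g) \<bullet> (- g) > 0" by simp
  moreover have "((\<lambda>x. - \<psi> x) has_derivative (\<lambda>h. (- g) \<bullet> h)) (at p)"
    using has_derivative_minus[OF assms(3)] by simp
  ultimately have "\<forall>\<^sub>F s in at_right 0. - \<psi> (p + s *\<^sub>R (- g)) > - \<psi> p"
    by (intro directional_increase)
  with eventually_in_open_right[OF assms(1,2), of "- g"] have "\<forall>\<^sub>F s::real in at_right 0. False"
    by eventually_elim (meson assms(4) linorder_not_less neg_less_iff_less)
  then show False by simp
qed

lemma frontier_inward:
  assumes "C1_defining_function \<Omega> p U \<rho>" "open \<Omega>" "p \<in> frontier \<Omega>" "grad \<rho> p \<bullet> v < 0"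
  shows "\<forall>\<^sub>F s in at_right 0. p + s *\<^sub>R v \<in> \<Omega>"
proof -
  note D = C1_defining_functionD[OF assms(1)]
  have r0: "\<rho> p = 0" using defining_function_zero assms D(2) by blast
  have "((\<lambda>x. - \<rho> x) has_derivative (\<lambda>h. (- grad \<rho> p) \<bullet> h)) (at p)"
    using has_derivative_minus[OF has_derivative_grad[OF D(3)[OF D(2)]]] by simp
  from directional_increase[OF this, of v] assms(4)
  have "\<forall>\<^sub>F s in at_right 0. \<rho> (p + s *\<^sub>R v) < 0" by (simp add: r0)
  with eventually_in_open_right[OF D(1,2), of v] show ?thesis
    by eventually_elim (use D(6) in blast)
qed

text \<open>
  The exterior is entered and not only the complement of the domain: the points where \<open>\<rho> > 0\<close>
  are neither in the domain nor, since \<open>\<rho>\<close> vanishes on the frontier, on its boundary.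
\<close>

lemma frontier_outward:
  assumes "C1_defining_function \<Omega> p U \<rho>" "open \<Omega>" "p \<in> frontier \<Omega>" "grad \<rho> p \<bullet> v > 0"
  shows "\<forall>\<^sub>F s in at_right 0. p + s *\<^sub>R v \<in> - closure \<Omega>"
proof -
  note D = C1_defining_functionD[OF assms(1)]
  have r0: "\<rho> p = 0" using defining_function_zero assms D(2) by blast
  from directional_increase[OF has_derivative_grad[OF D(3)[OF D(2)]] assms(4)]
  have "\<forall>\<^sub>F s in at_right 0. \<rho> (p + s *\<^sub>R v) > 0" by (simp add: r0)
  with eventually_in_open_right[OF D(1,2), of v] show ?thesis
  proof eventually_elim
    case (elim s)
    have "p + s *\<^sub>R v \<notin> \<Omega>" using D(6)[OF elim(1)] elim(2) by linarith
    moreover have "p + s *\<^sub>R v \<notin> frontier \<Omega>"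
      using defining_function_zero[OF assms(1,2) elim(1)] elim(2) by linarith
    ultimately
    show ?case by (simp add: closure_Un_frontier)
  qed
qed

text \<open>
  Makes the one-sided limits in the interface conditions unique.
\<close>

lemma frontier_limit_points:
  assumes "C1_defining_function \<Omega> p U \<rho>" "open \<Omega>" "p \<in> frontier \<Omega>"
  shows "at p within \<Omega> \<noteq> bot" "at p within - closure \<Omega> \<noteq> bot"
proof -
  note R = C1_defining_functionD[OF assms(1)]
  have p: "p \<in> closure \<Omega>" "p \<notin> \<Omega>" using assms(2,3) by (auto simp: frontier_def interior_open)
  then show "at p within \<Omega> \<noteq> bot" by (simp add: trivial_limit_within closure_def)
  have "grad \<rho> p \<bullet> grad \<rho> p > 0" using R(4)[OF R(2)] by simp
  have ev: "\<forall>\<^sub>F s in at_right 0. p + s *\<^sub>R grad \<rho> p \<in> closure (- closure \<Omega>)"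
    by (rule eventually_mono[OF frontier_outward[OF assms \<open>grad \<rho> p \<bullet> grad \<rho> p > 0\<close>]])
      (rule closure_subset[THEN subsetD])
  have "((\<lambda>s. p + s *\<^sub>R grad \<rho> p) \<longlongrightarrow> p + 0 *\<^sub>R grad \<rho> p) (at_right 0)"
    by (intro tendsto_intros)
  from Lim_in_closed_set[OF closed_closure ev trivial_limit_at_right_real this]
  have "p \<in> closure (- closure \<Omega>)" by simp
  then show "at p within - closure \<Omega> \<noteq> bot" using p by (auto simp: trivial_limit_within closure_def)
qed

lemma frontier_minimum_from_inside:
  assumes "C1_defining_function \<Omega> p U \<rho>" "open \<Omega>" "p \<in> frontier \<Omega>"
    and "(\<psi> has_derivative (\<lambda>h. g \<bullet> h)) (at p)" "\<And>x. x \<in> \<Omega> \<Longrightarrow> \<psi> p \<le> \<psi> x"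
  shows "\<exists>k\<ge>0. - g = k *\<^sub>R grad \<rho> p"
proof (rule half_space_multiple)
  note D = C1_defining_functionD[OF assms(1)]
  show "grad \<rho> p \<noteq> 0" using D by blast
  fix v assume v: "grad \<rho> p \<bullet> v < 0"
  show "- g \<bullet> v \<le> 0"
  proof (rule ccontr)
    assume "\<not> - g \<bullet> v \<le> 0"
    then have "\<forall>\<^sub>F s in at_right 0. - \<psi> (p + s *\<^sub>R v) > - \<psi> p"
      using has_derivative_minus[OF assms(4)] by (intro directional_increase[where n="-g"]) auto
    with frontier_inward[OF assms(1-3) v] have "\<forall>\<^sub>F s::real in at_right 0. False"
      by eventually_elim (meson assms(5) linorder_not_less neg_less_iff_less)
    then show False by simp
  qed
qed

lemma frontier_minimum_from_outside:
  assumes "C1_defining_function \<Omega> p U \<rho>" "open \<Omega>" "p \<in> frontier \<Omega>"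
    and "(\<psi> has_derivative (\<lambda>h. g \<bullet> h)) (at p)" "\<And>x. x \<notin> \<Omega> \<Longrightarrow> \<psi> p \<le> \<psi> x"
  shows "\<exists>k\<ge>0. g = k *\<^sub>R grad \<rho> p"
proof (rule half_space_multiple)
  show "grad \<rho> p \<noteq> 0" using C1_defining_functionD[OF assms(1)] by blast
  fix v assume v: "grad \<rho> p \<bullet> v < 0"
  show "g \<bullet> v \<le> 0"
  proof (rule ccontr)
    assume "\<not> g \<bullet> v \<le> 0"
    then have "\<forall>\<^sub>F s in at_right 0. - \<psi> (p + s *\<^sub>R (-v)) > - \<psi> p"
      using has_derivative_minus[OF assms(4)] by (intro directional_increase[where n="-g"]) auto
    moreover have "\<forall>\<^sub>F s in at_right 0. p + s *\<^sub>R (-v) \<in> - closure \<Omega>"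
      using frontier_outward[OF assms(1-3), of "-v"] v by simp
    ultimately have "\<forall>\<^sub>F s::real in at_right 0. False"
    proof eventually_elim
      case (elim s)
      have "p + s *\<^sub>R (-v) \<notin> \<Omega>" using elim(2) closure_subset by blast
      from assms(5)[OF this] elim(1) show ?case by linarith
    qed
    then show False by simp
  qed
qed

text \<open>
  Two defining functions agree on which directions enter the domain and which enter the exterior,
  so their gradients are positive multiples of each other and the description of the normal is unambiguous.
\<close>

lemma outward_normal_eq:
  assumes "C1_defining_function \<Omega> p U \<rho>" "open \<Omega>" "p \<in> frontier \<Omega>"
  shows "outward_normal \<Omega> p = grad \<rho> p /\<^sub>R norm (grad \<rho> p)"
  unfolding outward_normal_def
proof (rule the_equality)
  show "\<exists>U \<rho>'. C1_defining_function \<Omega> p U \<rho>' \<and>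
      grad \<rho> p /\<^sub>R norm (grad \<rho> p) = grad \<rho>' p /\<^sub>R norm (grad \<rho>' p)"
    using assms by blast
next
  fix n assume "\<exists>U \<rho>. C1_defining_function \<Omega> p U \<rho> \<and> n = grad \<rho> p /\<^sub>R norm (grad \<rho> p)"
  then obtain U' \<rho>' where D': "C1_defining_function \<Omega> p U' \<rho>'"
    and n: "n = grad \<rho>' p /\<^sub>R norm (grad \<rho>' p)" by blast
  note D = C1_defining_functionD[OF assms(1)]
  note E = C1_defining_functionD[OF D']
  have "\<exists>k\<ge>0. grad \<rho> p = k *\<^sub>R grad \<rho>' p"
  proof (rule half_space_multiple)
    show "grad \<rho>' p \<noteq> 0" using E by blast
    fix v assume v: "grad \<rho>' p \<bullet> v < 0"
    show "grad \<rho> p \<bullet> v \<le> 0"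
    proof (rule ccontr)
      assume "\<not> grad \<rho> p \<bullet> v \<le> 0"
      then have "\<forall>\<^sub>F s in at_right 0. p + s *\<^sub>R v \<in> - closure \<Omega>"
        by (intro frontier_outward[OF assms]) simp
      with frontier_inward[OF D' assms(2,3) v] have "\<forall>\<^sub>F s::real in at_right 0. False"
        by eventually_elim (meson ComplD closure_subset subsetD)
      then show False by simp
    qed
  qed
  then obtain k where k: "k \<ge> 0" "grad \<rho> p = k *\<^sub>R grad \<rho>' p" by blast
  moreover have "k \<noteq> 0" using k(2) D(4)[OF D(2)] by auto
  ultimately have "k > 0" by linarith
  with k n show "n = grad \<rho> p /\<^sub>R norm (grad \<rho> p)" by simp
qed

section \<open>Integrating derivatives of compactly supported functions\<close>

text \<open>
  The difference quotients of \<open>f\<close> have integral zero by translation invariance, and they converge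
  boundedly to the directional derivative.
\<close>

lemma integral_directional_derivative_UNIV:
  fixes f :: "'a::euclidean_space \<Rightarrow> real"
  assumes der: "\<And>x. (f has_derivative f' x) (at x)"
    and cont: "continuous_on UNIV (\<lambda>x. f' x e)"
    and K: "compact K" "\<And>x. x \<notin> K \<Longrightarrow> f x = 0"
  shows "(\<integral>x. f' x e \<partial>lborel) = 0"
proof -
  define g where "g x = f' x e" for x
  define q where "q n x = real (Suc n) * (f (x + (1 / real (Suc n)) *\<^sub>R e) - f x)" for n x
  \<comment> \<open>The difference quotients with steps in \<open>(0, 1]\<close> vanish off this compact set.\<close>
  define K' where "K' = (\<lambda>(x, t). x - t *\<^sub>R e) ` (K \<times> {0..1::real})"
  have contf: "continuous_on UNIV f"
    using der by (meson continuous_at_imp_continuous_on has_derivative_continuous)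
  have K': "compact K'"
    unfolding K'_def using K(1)
    by (intro compact_continuous_image compact_Times) (auto simp: case_prod_beta intro!: continuous_intros)
  have g0: "g x = 0" if "x \<notin> K" for x
  proof -
    have "(f has_derivative (\<lambda>_. 0)) (at x)"
      by (rule has_derivative_transform_within_open[of "\<lambda>_. 0" _ _ _ "- K"])
         (use that K compact_imp_closed in auto)
    with der[of x] have "f' x = (\<lambda>_. 0)" by (rule has_derivative_unique)
    then show ?thesis by (simp add: g_def)
  qed
  have "bounded (g ` K)"
    by (intro compact_imp_bounded compact_continuous_image continuous_on_subset[OF cont[folded g_def]] K) auto
  then obtain M where M: "M > 0" "\<And>x. x \<in> K \<Longrightarrow> norm (g x) \<le> M"
    unfolding bounded_pos by auto
  have gM: "\<bar>g x\<bar> \<le> M" for x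
    using M g0[of x] by (cases "x \<in> K") auto
  have line: "((\<lambda>t. f (x + t *\<^sub>R e)) has_real_derivative g (x + t *\<^sub>R e)) (at t)" for x t
  proof -
    interpret D: linear "f' (x + t *\<^sub>R e)" using der has_derivative_linear by blast
    have "((\<lambda>t. f (x + t *\<^sub>R e)) has_derivative (\<lambda>s. f' (x + t *\<^sub>R e) (s *\<^sub>R e))) (at t)"
      by (rule has_derivative_compose[of "\<lambda>t. x + t *\<^sub>R e" "\<lambda>s. s *\<^sub>R e" t UNIV f "f' (x + t *\<^sub>R e)"])
         (use der in \<open>auto intro!: derivative_eq_intros\<close>)
    then show ?thesis
      by (simp add: has_field_derivative_def D.scale g_def mult_commute_abs)
  qed
  have q_M: "\<bar>q n x\<bar> \<le> M" for n x
  proof -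
    have "\<exists>z. z > 0 \<and> z < 1 / real (Suc n) \<and> f (x + (1 / real (Suc n)) *\<^sub>R e) - f (x + 0 *\<^sub>R e)
         = (1 / real (Suc n) - 0) * g (x + z *\<^sub>R e)"
      using line by (intro MVT2) auto
    then obtain z where "f (x + (1 / real (Suc n)) *\<^sub>R e) - f x = (1 / real (Suc n)) * g (x + z *\<^sub>R e)"
      by auto
    then have "q n x = g (x + z *\<^sub>R e)" unfolding q_def by simp
    then show ?thesis using gM by simp
  qed
  have q_0: "q n x = 0" if "x \<notin> K'" for n x
  proof -
    have "y - t *\<^sub>R e \<noteq> x" if "y \<in> K" "0 \<le> t" "t \<le> 1" for y t
      using \<open>x \<notin> K'\<close> that unfolding K'_def by force
    from this[of x 0] this[of "x + (1 / real (Suc n)) *\<^sub>R e" "1 / real (Suc n)"]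
    have "x \<notin> K" "x + (1 / real (Suc n)) *\<^sub>R e \<notin> K" by auto
    then show ?thesis using K(2) by (simp add: q_def)
  qed
  have meas: "f \<in> borel_measurable lborel" "(\<lambda>x. f (x + a)) \<in> borel_measurable lborel" for a
    using contf by (auto intro!: borel_measurable_continuous_onI continuous_intros
        continuous_on_compose2[OF contf])
  have "integrable lborel (\<lambda>x. indicator K x *\<^sub>R f x)"
    by (intro borel_integrable_compact K continuous_on_subset[OF contf]) auto
  also have "(\<lambda>x. indicator K x *\<^sub>R f x) = f"
    using K(2) by (intro ext) (auto simp: indicator_def)
  finally have intf: "integrable lborel f" .
  have shift: "integrable lborel (\<lambda>x. f (x + a))" "(\<integral>x. f (x + a) \<partial>lborel) = (\<integral>x. f x \<partial>lborel)" for a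
  proof -
    have "integrable (distr lborel borel ((+) a)) f" using intf by (simp add: lborel_distr_plus)
    then show "integrable lborel (\<lambda>x. f (x + a))"
      using integrable_distr[of "(+) a" lborel borel f] by (simp add: add.commute)
    show "(\<integral>x. f (x + a) \<partial>lborel) = (\<integral>x. f x \<partial>lborel)"
      using integral_distr[of "(+) a" lborel borel f] meas by (simp add: lborel_distr_plus add.commute)
  qed
  have q_int: "(\<integral>x. q n x \<partial>lborel) = 0" for n
    unfolding q_def using shift intf by simp
  have "(\<lambda>n. \<integral>x. q n x \<partial>lborel) \<longlonglongrightarrow> (\<integral>x. g x \<partial>lborel)"
  proof (rule integral_dominated_convergence[where w="\<lambda>x. indicator K' x * M"])
    show "g \<in> borel_measurable lborel"
      using cont by (simp add: g_def borel_measurable_continuous_onI)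
    show "q n \<in> borel_measurable lborel" for n
      unfolding q_def using meas by measurable
    show "integrable lborel (\<lambda>x. indicator K' x * M)"
      using K' by (auto intro!: integrable_mult_left emeasure_compact_finite borel_compact)
    show "AE x in lborel. norm (q n x) \<le> indicator K' x * M" for n
      using q_M q_0 by (auto simp: indicator_def)
    show "AE x in lborel. (\<lambda>n. q n x) \<longlonglongrightarrow> g x"
    proof (rule AE_I2)
      fix x
      have "((\<lambda>h. (f (x + (0 + h) *\<^sub>R e) - f (x + 0 *\<^sub>R e)) / h) \<longlongrightarrow> g (x + 0 *\<^sub>R e)) (at 0)"
        using line[of x 0] unfolding DERIV_def .
      then have "((\<lambda>h. (f (x + h *\<^sub>R e) - f x) / h) \<longlongrightarrow> g x) (at 0)" by simp
      moreover have "filterlim (\<lambda>n. 1 / real (Suc n)) (at 0) sequentially"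
        unfolding filterlim_at using lim_1_over_n[THEN LIMSEQ_Suc] by auto
      ultimately have "(\<lambda>n. (f (x + (1 / real (Suc n)) *\<^sub>R e) - f x) / (1 / real (Suc n))) \<longlonglongrightarrow> g x"
        by (rule filterlim_compose)
      then show "(\<lambda>n. q n x) \<longlonglongrightarrow> g x" by (simp add: q_def mult.commute)
    qed
  qed
  then have "(\<lambda>n. 0 :: real) \<longlonglongrightarrow> (\<integral>x. g x \<partial>lborel)" by (simp only: q_int)
  then have "(\<integral>x. g x \<partial>lborel) = 0" by (simp add: LIMSEQ_const_iff)
  then show ?thesis by (simp add: g_def)
qed

text \<open>
  The extension of \<open>f\<close> by zero is differentiable everywhere, since \<open>f\<close> already vanishes on
  \<open>V\<close> off the compact set \<open>K\<close>.
\<close>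

lemma integral_directional_derivative:
  fixes f :: "'a::euclidean_space \<Rightarrow> real"
  assumes V: "open V" and K: "compact K" "K \<subseteq> V"
    and der: "\<And>x. x \<in> V \<Longrightarrow> (f has_derivative f' x) (at x)"
    and cont: "continuous_on V (\<lambda>x. f' x e)"
    and zero: "\<And>x. x \<in> V - K \<Longrightarrow> f x = 0"
  shows "integrable lborel (\<lambda>x. indicator V x * f' x e)"
    and "(\<integral>x. indicator V x * f' x e \<partial>lborel) = 0"
proof -
  define g where "g x = (if x \<in> V then f x else 0)" for x
  define g' where "g' x = (if x \<in> V then f' x else (\<lambda>_. 0))" for x
  have oK: "open (- K)" using K(1) compact_imp_closed by blast
  have g': "(g has_derivative g' x) (at x)" for x
  proof (cases "x \<in> V")
    case True
    then show ?thesis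
      using has_derivative_transform_within_open[OF der[OF True] V True, of g] by (simp add: g_def g'_def)
  next
    case False
    with K(2) have "x \<in> - K" by blast
    then show ?thesis
      using has_derivative_transform_within_open[OF has_derivative_const oK, of x 0 g] zero False
      by (auto simp: g_def g'_def)
  qed
  have g'0: "g' x = (\<lambda>_. 0)" if "x \<in> - K" for x
  proof -
    have "(g has_derivative (\<lambda>_. 0)) (at x)"
      using has_derivative_transform_within_open[OF has_derivative_const oK that, of 0 g] zero
      by (auto simp: g_def)
    with g' show ?thesis by (rule has_derivative_unique)
  qed
  have "continuous_on (V \<union> - K) (\<lambda>x. g' x e)"
  proof (rule continuous_on_open_Un[OF V oK])
    show "continuous_on V (\<lambda>x. g' x e)"
      using cont by (rule continuous_on_eq) (simp add: g'_def)
    show "continuous_on (- K) (\<lambda>x. g' x e)"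
      by (rule continuous_on_eq[of _ "\<lambda>_. 0"]) (auto simp: g'0)
  qed
  moreover have "V \<union> - K = UNIV" using K by blast
  ultimately have c: "continuous_on UNIV (\<lambda>x. g' x e)" by simp
  have eq: "indicator V x * f' x e = g' x e" for x by (simp add: g'_def)
  have "(\<integral>x. g' x e \<partial>lborel) = 0"
    using K zero by (intro integral_directional_derivative_UNIV[OF g' c K(1)]) (auto simp: g_def)
  then show "(\<integral>x. indicator V x * f' x e \<partial>lborel) = 0" by (simp add: eq)
  have "integrable lborel (\<lambda>x. indicator K x *\<^sub>R g' x e)"
    by (intro borel_integrable_compact K continuous_on_subset[OF c]) auto
  also have "(\<lambda>x. indicator K x *\<^sub>R g' x e) = (\<lambda>x. indicator V x * f' x e)"
    using g'0 unfolding eq by (intro ext) (auto simp: indicator_def)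
  finally show "integrable lborel (\<lambda>x. indicator V x * f' x e)" .
qed

section \<open>Cutoff functions and thin boundary layers\<close>

lemma DERIV_pos_part_square:
  "((\<lambda>t::real. (max 0 t)\<^sup>2) has_real_derivative 2 * max 0 t) (at t)"
proof (cases t "0::real" rule: linorder_cases)
  case less
  have "((\<lambda>t::real. 0) has_real_derivative 0) (at t)" by simp
  then have "((\<lambda>t::real. (max 0 t)\<^sup>2) has_real_derivative 0) (at t)"
    by (rule has_field_derivative_transform_within_open[where S="{..<0}"]) (use less in \<open>auto simp: max_def\<close>)
  then show ?thesis using less by (simp add: max_def)
next
  case equal
  have "((\<lambda>h::real. max 0 h) \<longlongrightarrow> 0) (at 0)"
    using tendsto_max[OF tendsto_const[of "0::real"] tendsto_ident_at[of "0::real" UNIV]] by simp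
  then have "((\<lambda>h::real. ((max 0 h)\<^sup>2 - 0) / h) \<longlongrightarrow> 0) (at 0)"
    by (rule Lim_transform_eventually)
       (auto simp: eventually_at max_def power2_eq_square intro!: exI[of _ 1])
  then show ?thesis using equal by (simp add: DERIV_def)
next
  case greater
  have "((\<lambda>t::real. t\<^sup>2) has_real_derivative 2 * t) (at t)"
    by (auto intro!: derivative_eq_intros)
  then have "((\<lambda>t::real. (max 0 t)\<^sup>2) has_real_derivative 2 * t) (at t)"
    by (rule has_field_derivative_transform_within_open[where S="{0<..}"]) (use greater in \<open>auto simp: max_def\<close>)
  then show ?thesis using greater by (simp add: max_def)
qed

text \<open>
  The quotient \<open>m t / (m t + m (1 - t))\<close> of squared positive parts \<open>m\<close>.
\<close>

lemma C1_step_function: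
  obtains h h' :: "real \<Rightarrow> real" and C :: real where
    "\<And>t. (h has_real_derivative h' t) (at t)" "continuous_on UNIV h'"
    "\<And>t. t \<le> 0 \<Longrightarrow> h t = 0" "\<And>t. t \<ge> 1 \<Longrightarrow> h t = 1" "\<And>t. 0 \<le> h t \<and> h t \<le> 1"
    "\<And>t. t \<le> 0 \<or> t \<ge> 1 \<Longrightarrow> h' t = 0" "\<And>t. \<bar>h' t\<bar> \<le> C" "0 \<le> C"
proof -
  define m where "m t = (max 0 t)\<^sup>2" for t :: real
  define h where "h t = m t / (m t + m (1 - t))" for t
  define h' where "h' t = (2 * max 0 t * (m t + m (1 - t))
     - m t * (2 * max 0 t - 2 * max 0 (1 - t))) / (m t + m (1 - t))\<^sup>2" for t
  have m: "(m has_real_derivative 2 * max 0 t) (at t)" for t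
    unfolding m_def by (rule DERIV_pos_part_square)
  have m1: "((\<lambda>t. m (1 - t)) has_real_derivative - 2 * max 0 (1 - t)) (at t)" for t
  proof -
    have "((\<lambda>t. 1 - t) has_real_derivative - 1) (at t)" by (auto intro!: derivative_eq_intros)
    from DERIV_chain2[OF m this] show ?thesis by simp
  qed
  have pos: "m t + m (1 - t) > 0" for t
    unfolding m_def by (cases "t > 0") (auto simp: max_def intro: add_pos_nonneg)
  have m0: "m t \<ge> 0" for t by (simp add: m_def)
  have a: "(h has_real_derivative h' t) (at t)" for t
  proof -
    have "m t + m (1 - t) \<noteq> 0" using pos[of t] by simp
    from DERIV_divide[OF m DERIV_add[OF m m1] this] show ?thesis
      unfolding h_def h'_def by (simp add: power2_eq_square)
  qed
  have cm: "continuous_on UNIV m" unfolding m_def by (intro continuous_intros)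
  have b: "continuous_on UNIV h'"
    unfolding h'_def using pos
    by (intro continuous_intros continuous_on_compose2[OF cm]) (auto simp: less_imp_neq[symmetric])
  have e: "h' t = 0" if "t \<le> 0 \<or> t \<ge> 1" for t
    using that by (auto simp: h'_def m_def max_def)
  have "bounded (h' ` {0..1})"
    by (intro compact_imp_bounded compact_continuous_image continuous_on_subset[OF b]) auto
  then obtain C where C: "C > 0" "\<And>t. t \<in> {0..1} \<Longrightarrow> norm (h' t) \<le> C"
    unfolding bounded_pos by auto
  have f: "\<bar>h' t\<bar> \<le> C" for t using C(2)[of t] C(1) e[of t] by (cases "t \<in> {0..1}") auto
  have c: "h t = 0" if "t \<le> 0" for t using that by (simp add: h_def m_def max_def)
  have d: "h t = 1" if "t \<ge> 1" for t using that by (simp add: h_def m_def max_def)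
  have g: "0 \<le> h t \<and> h t \<le> 1" for t
    using m0[of t] m0[of "1-t"] pos[of t] by (simp add: h_def field_simps)
  show ?thesis by (rule that[OF a b c d g e f less_imp_le[OF C(1)]])
qed

text \<open>
  As \<open>\<rho>\<close> grows at rate at least \<open>c\<close> in direction \<open>e\<close>, shifting the layer by
  \<open>2 e / n\<close> raises \<open>\<rho>\<close> by more than the width of the layer. Hence \<open>n\<close> successive shifts
  are disjoint; they all lie in one ball, and each has the measure of the layer.
\<close>

lemma measure_thin_layer:
  fixes \<rho> :: "real^'d \<Rightarrow> real"
  assumes U: "cball p r \<subseteq> U" and cont: "continuous_on U \<rho>"
    and der: "\<And>x. x \<in> cball p r \<Longrightarrow> (\<rho> has_derivative (\<lambda>h. g x \<bullet> h)) (at x)"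
    and c: "0 < c" "\<And>x. x \<in> cball p r \<Longrightarrow> c \<le> g x \<bullet> e"
    and n: "n > 0" and ab: "b - a \<le> c / real n"
  shows "measure lborel {x \<in> cball p r. a \<le> \<rho> x \<and> \<rho> x \<le> b}
     \<le> measure lborel (cball p (r + 2 * norm e)) / real n"
proof -
  define L where "L = {x \<in> cball p r. a \<le> \<rho> x \<and> \<rho> x \<le> b}"
  have incr: "\<rho> x + c * t \<le> \<rho> (x + t *\<^sub>R e)"
    if x: "x \<in> cball p r" "x + t *\<^sub>R e \<in> cball p r" and t: "t > 0" for x t
  proof -
    have seg: "x + s *\<^sub>R e \<in> cball p r" if "0 \<le> s" "s \<le> t" for s
    proof -
      have "x + s *\<^sub>R e = (1 - s / t) *\<^sub>R x + (s / t) *\<^sub>R (x + t *\<^sub>R e)"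
        using t by (simp add: algebra_simps)
      then show ?thesis
        using convexD_alt[OF convex_cball x, of "s / t"] that t by simp
    qed
    have "((\<lambda>s. \<rho> (x + s *\<^sub>R e)) has_real_derivative g (x + s *\<^sub>R e) \<bullet> e) (at s)"
      if "0 \<le> s" "s \<le> t" for s
    proof -
      have "((\<lambda>s. \<rho> (x + s *\<^sub>R e)) has_derivative (\<lambda>k. g (x + s *\<^sub>R e) \<bullet> (k *\<^sub>R e))) (at s)"
        by (rule has_derivative_compose[of "\<lambda>s. x + s *\<^sub>R e" "\<lambda>k. k *\<^sub>R e" s UNIV \<rho> "\<lambda>h. g (x + s *\<^sub>R e) \<bullet> h"])
           (use der[OF seg[OF that]] in \<open>auto intro!: derivative_eq_intros\<close>)
      then show ?thesis by (simp add: has_field_derivative_def mult_commute_abs)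
    qed
    then obtain z where z: "0 < z" "z < t" "\<rho> (x + t *\<^sub>R e) - \<rho> (x + 0 *\<^sub>R e) = (t - 0) * (g (x + z *\<^sub>R e) \<bullet> e)"
      using MVT2[OF t, of "\<lambda>s. \<rho> (x + s *\<^sub>R e)" "\<lambda>s. g (x + s *\<^sub>R e) \<bullet> e"] by auto
    have "c * t \<le> t * (g (x + z *\<^sub>R e) \<bullet> e)"
      using c(2)[OF seg[of z]] z t by (simp add: mult.commute)
    moreover have "\<rho> (x + t *\<^sub>R e) - \<rho> x = t * (g (x + z *\<^sub>R e) \<bullet> e)" using z(3) by simp
    ultimately show ?thesis by linarith
  qed
  define T where "T j = (+) ((2 * real j / real n) *\<^sub>R e) ` L" for j :: nat
  have "closed {x \<in> cball p r. \<rho> x \<in> {a..b}}"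
    using continuous_closed_preimage[OF continuous_on_subset[OF cont U] closed_cball closed_atLeastAtMost[of a b]]
    by (simp add: vimage_def Int_def)
  then have "compact (cball p r \<inter> {x \<in> cball p r. \<rho> x \<in> {a..b}})" by (intro compact_Int_closed) auto
  also have "cball p r \<inter> {x \<in> cball p r. \<rho> x \<in> {a..b}} = L" by (auto simp: L_def)
  finally have L: "compact L" .
  have T: "compact (T j)" for j
    unfolding T_def by (intro compact_continuous_image L continuous_intros)
  have disj: "disjnt (T i) (T j)" if "i < j" for i j
  proof (rule ccontr)
    assume "\<not> disjnt (T i) (T j)"
    then obtain x y where xy: "x \<in> L" "y \<in> L"
      "(2 * real i / real n) *\<^sub>R e + x = (2 * real j / real n) *\<^sub>R e + y"
      unfolding disjnt_def T_def by blast
    define t where "t = 2 * real j / real n - 2 * real i / real n"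
    have "real i + 1 \<le> real j" using that by linarith
    then have t: "t \<ge> 2 / real n" using n by (simp add: t_def divide_simps)
    have x: "x = y + t *\<^sub>R e"
      unfolding t_def scaleR_left_diff_distrib using xy(3) by (metis add.commute add_diff_eq diff_add_cancel)
    have "t > 0" using t n by (intro less_le_trans[OF _ t]) simp
    have "\<rho> y + c * t \<le> \<rho> x"
      using incr[of y t] xy(1,2) x \<open>t > 0\<close> by (simp add: L_def)
    moreover have "c * t \<ge> c * (2 / real n)" using c t by (intro mult_left_mono) auto
    moreover have "c * (2 / real n) > c / real n" using c n by (simp add: field_simps)
    ultimately have "\<rho> x - \<rho> y > c / real n" by linarith
    moreover have "\<rho> x \<le> b" "a \<le> \<rho> y" using xy by (auto simp: L_def)
    ultimately show False using ab by linarith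
  qed
  have "measure lebesgue (\<Union>j\<in>{..<n}. T j) = (\<Sum>j<n. measure lebesgue (T j))"
  proof (rule measure_UNION')
    show "pairwise (\<lambda>i j. disjnt (T i) (T j)) {..<n}"
      unfolding pairwise_def by (metis disj disjnt_sym linorder_neqE_nat)
    show "T j \<in> lmeasurable" for j using T by (rule lmeasurable_compact)
  qed simp
  also have "\<dots> = (\<Sum>j<n. measure lebesgue L)"
    unfolding T_def by (simp add: measure_translation)
  also have "\<dots> = real n * measure lborel L"
    using L by (simp add: measure_completion borel_compact)
  finally have "real n * measure lborel L = measure lebesgue (\<Union>j\<in>{..<n}. T j)" by simp
  also have "\<dots> \<le> measure lebesgue (cball p (r + 2 * norm e))"
  proof (rule measure_mono_fmeasurable)
    show "(\<Union>j\<in>{..<n}. T j) \<subseteq> cball p (r + 2 * norm e)"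
    proof safe
      fix j y assume "j < n" "y \<in> T j"
      then obtain x where x: "x \<in> L" "y = (2 * real j / real n) *\<^sub>R e + x" by (auto simp: T_def)
      have "dist p y \<le> dist p x + norm ((2 * real j / real n) *\<^sub>R e)"
        using dist_triangle[of p y x] x(2) by (simp add: dist_norm norm_minus_commute)
      also have "norm ((2 * real j / real n) *\<^sub>R e) \<le> 2 * norm e"
        using \<open>j < n\<close> by (simp add: field_simps mult_left_mono mult_right_mono)
      finally show "y \<in> cball p (r + 2 * norm e)" using x by (simp add: L_def)
    qed
    show "(\<Union>j\<in>{..<n}. T j) \<in> sets lebesgue"
      using fmeasurableD[OF lmeasurable_compact[OF T]] by (intro sets.finite_UN) auto
    show "cball p (r + 2 * norm e) \<in> fmeasurable lebesgue"
      by (rule lmeasurable_compact) simp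
  qed
  also have "\<dots> = measure lborel (cball p (r + 2 * norm e))"
    by (simp add: measure_completion)
  finally show ?thesis using n unfolding L_def by (simp add: field_simps)
qed

text \<open>
  By compactness: points of the domain approaching the zero level of \<open>\<rho>\<close> accumulate at
  frontier points, where \<open>\<kappa>\<close> tends to zero.
\<close>

lemma small_near_zero_level:
  fixes \<rho> \<kappa> :: "real^'d \<Rightarrow> real"
  assumes \<Omega>: "open \<Omega>" and \<rho>: "C1_defining_function \<Omega> p U \<rho>" and r: "cball q r \<subseteq> U"
    and lim: "\<And>x. x \<in> U \<inter> frontier \<Omega> \<Longrightarrow> (\<kappa> \<longlongrightarrow> 0) (at x within \<Omega>)"
    and "\<epsilon> > 0"
  shows "\<exists>\<delta>>0. \<forall>x \<in> \<Omega> \<inter> cball q r. - \<delta> \<le> \<rho> x \<longrightarrow> \<bar>\<kappa> x\<bar> < \<epsilon>"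
proof (rule ccontr)
  note D = C1_defining_functionD[OF \<rho>]
  assume "\<not> ?thesis"
  then have "\<forall>n. \<exists>x. x \<in> \<Omega> \<inter> cball q r \<and> - (1 / real (Suc n)) \<le> \<rho> x \<and> \<not> \<bar>\<kappa> x\<bar> < \<epsilon>"
    by (metis divide_pos_pos of_nat_0_less_iff zero_less_Suc zero_less_one)
  then obtain X where X: "\<And>n. X n \<in> \<Omega>" "\<And>n. X n \<in> cball q r"
    "\<And>n. - (1 / real (Suc n)) \<le> \<rho> (X n)" "\<And>n. \<not> \<bar>\<kappa> (X n)\<bar> < \<epsilon>"
    by (metis IntE)
  obtain x s where x: "x \<in> cball q r" and s: "strict_mono s" and lim_x: "(X \<circ> s) \<longlonglongrightarrow> x"
    using compact_cball[of q r] X(2) unfolding compact_def by meson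
  have xU: "x \<in> U" using x r by blast
  have "isCont \<rho> x" using D(1,7) xU by (simp add: continuous_on_eq_continuous_at)
  then have "(\<lambda>n. \<rho> ((X \<circ> s) n)) \<longlonglongrightarrow> \<rho> x" using lim_x by (rule isCont_tendsto_compose)
  moreover have "(\<lambda>n. - (1 / real (Suc (s n)))) \<longlonglongrightarrow> 0"
  proof -
    have "(\<lambda>n. - (1 / real (Suc n))) \<longlonglongrightarrow> - 0"
      by (intro tendsto_minus LIMSEQ_Suc[OF lim_1_over_n])
    from LIMSEQ_subseq_LIMSEQ[OF this s] show ?thesis by (simp add: o_def)
  qed
  moreover have "\<exists>N. \<forall>n\<ge>N. - (1 / real (Suc (s n))) \<le> \<rho> ((X \<circ> s) n)" using X(3) by auto
  ultimately have "0 \<le> \<rho> x" by (meson LIMSEQ_le)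
  then have "x \<notin> \<Omega>" using D(6)[OF xU] by simp
  moreover have "x \<in> closure \<Omega>"
    using X(1) lim_x unfolding closure_sequential by (intro exI[of _ "X \<circ> s"]) auto
  ultimately have fr: "x \<in> frontier \<Omega>" using \<Omega> by (simp add: frontier_def interior_open)
  have "filterlim (X \<circ> s) (at x within \<Omega>) sequentially"
    unfolding filterlim_at
  proof (intro conjI always_eventually allI)
    fix n show "(X \<circ> s) n \<in> \<Omega>" using X(1) by simp
    then show "(X \<circ> s) n \<noteq> x" using \<open>x \<notin> \<Omega>\<close> by metis
  qed (rule lim_x)
  with lim[of x] fr xU have "(\<lambda>n. \<kappa> ((X \<circ> s) n)) \<longlonglongrightarrow> 0"
    by (blast intro: filterlim_compose[of \<kappa> "nhds 0" "at x within \<Omega>"])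
  then have "\<forall>\<^sub>F n in sequentially. dist (\<kappa> ((X \<circ> s) n)) 0 < \<epsilon>"
    using \<open>\<epsilon> > 0\<close> by (rule tendstoD)
  then have "\<forall>\<^sub>F n::nat in sequentially. False"
    by eventually_elim (use X(4) in auto)
  then show False by simp
qed

section \<open>Uniqueness for the Neumann problem\<close>

text \<open>
  The gradient is carried along explicitly, since only its values on the domain matter.
\<close>

definition test_function :: "(real^'d) set \<Rightarrow> (real^'d \<Rightarrow> real) \<Rightarrow> (real^'d \<Rightarrow> real^'d) \<Rightarrow> bool" where
  "test_function \<Omega> \<phi> D \<longleftrightarrow>
     (\<forall>x\<in>\<Omega>. (\<phi> has_derivative (\<lambda>h. D x \<bullet> h)) (at x)) \<and> continuous_on \<Omega> D \<and>
     (\<exists>M. \<forall>x\<in>\<Omega>. \<bar>\<phi> x\<bar> \<le> M \<and> norm (D x) \<le> M)"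

text \<open>
  Integration by parts against a divergence-free field \<open>G\<close> with vanishing normal component at
  the boundary, for test functions supported near \<open>p\<close>. The test function is multiplied by
  \<open>h (- k \<rho> - 1)\<close>, where \<open>h\<close> is a step from \<open>0\<close> to \<open>1\<close>: this cuts it off inside the
  domain, and the resulting error term tends to zero as \<open>k\<close> grows because
  \<open>G \<bullet> grad \<rho>\<close> does so on the layer where the step takes place. Points \<open>p\<close> of
  the domain are covered through a \<open>\<rho>\<close> without zeros near \<open>p\<close>.
\<close>

lemma local_green:
  fixes G :: "real^'d \<Rightarrow> real^'d"
  assumes \<Omega>: "open \<Omega>" and \<rho>: "C1_defining_function \<Omega> p U \<rho>"
    and der: "\<And>x. x \<in> \<Omega> \<Longrightarrow> (G has_derivative H x) (at x)"
    and cont: "\<And>v. continuous_on \<Omega> (\<lambda>x. H x v)"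
    and div: "\<And>x. x \<in> \<Omega> \<Longrightarrow> trace (matrix (H x)) = 0"
    and bnd: "\<And>x. x \<in> \<Omega> \<Longrightarrow> norm (G x) \<le> MG"
    and flux: "\<And>x. x \<in> U \<inter> frontier \<Omega> \<Longrightarrow> ((\<lambda>y. G y \<bullet> grad \<rho> y) \<longlongrightarrow> 0) (at x within \<Omega>)"
  obtains r where "r > 0"
    "\<And>\<phi> D. test_function \<Omega> \<phi> D \<Longrightarrow> (\<And>x. x \<in> \<Omega> - cball p r \<Longrightarrow> \<phi> x = 0 \<and> D x = 0) \<Longrightarrow>
       (\<integral>x. indicator \<Omega> x * (D x \<bullet> G x) \<partial>lborel) = 0"
proof -
  note R = C1_defining_functionD[OF \<rho>]
  define e where "e = grad \<rho> p"
  \<comment> \<open>Half of the slope of \<open>\<rho>\<close> in direction \<open>e\<close> at \<open>p\<close>, so that it bounds the slope from below near \<open>p\<close>.\<close>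
  define c where "c = (e \<bullet> e) / 2"
  have c: "c > 0" using R(2,4) by (simp add: c_def e_def)
  have "isCont (\<lambda>x. grad \<rho> x \<bullet> e) p"
    using R(1,2,5) by (intro continuous_intros) (simp add: continuous_on_eq_continuous_at)
  then have "\<forall>\<^sub>F x in at p. grad \<rho> x \<bullet> e > c"
    using c unfolding isCont_def by (intro order_tendstoD(1)) (auto simp: e_def c_def)
  then obtain d where d: "d > 0" "\<And>x. x \<noteq> p \<Longrightarrow> dist x p < d \<Longrightarrow> grad \<rho> x \<bullet> e > c"
    unfolding eventually_at by auto
  obtain d' where d': "d' > 0" "cball p d' \<subseteq> U" using R(1,2) open_contains_cball by blast
  define r where "r = min (d / 2) d'"
  have r: "r > 0" "cball p r \<subseteq> U" using d(1) d' by (auto simp: r_def)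
  have c': "c \<le> grad \<rho> x \<bullet> e" if "x \<in> cball p r" for x
  proof (cases "x = p")
    case True then show ?thesis using c by (simp add: c_def e_def)
  next
    case False
    then show ?thesis using d that by (force simp: r_def dist_commute)
  qed
  obtain h h' C where h: "\<And>t. (h has_real_derivative h' t) (at t)" "continuous_on UNIV h'"
    "\<And>t. t \<le> 0 \<Longrightarrow> h t = 0" "\<And>t. t \<ge> 1 \<Longrightarrow> h t = 1" "\<And>t. 0 \<le> h t \<and> h t \<le> 1"
    "\<And>t. t \<le> 0 \<or> t \<ge> 1 \<Longrightarrow> h' t = 0" "\<And>t. \<bar>h' t\<bar> \<le> C" "0 \<le> C"
    by (rule C1_step_function) (rule that; assumption)
  define V where "V = \<Omega> \<inter> U"
  have V: "open V" using \<Omega> R(1) by (simp add: V_def open_Int)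
  have cG: "continuous_on \<Omega> G"
    using der by (meson continuous_at_imp_continuous_on has_derivative_continuous)
  define V0 where "V0 = measure lborel (cball p (r + 2 * norm e))"
  have main: "(\<integral>x. indicator \<Omega> x * (D x \<bullet> G x) \<partial>lborel) = 0"
    if tf: "test_function \<Omega> \<phi> D" and out: "\<And>x. x \<in> \<Omega> - cball p r \<Longrightarrow> \<phi> x = 0 \<and> D x = 0" for \<phi> D
  proof -
    have d\<phi>: "\<And>x. x \<in> \<Omega> \<Longrightarrow> (\<phi> has_derivative (\<lambda>h. D x \<bullet> h)) (at x)" and cD: "continuous_on \<Omega> D"
      using tf by (auto simp: test_function_def)
    obtain M where M: "\<And>x. x \<in> \<Omega> \<Longrightarrow> \<bar>\<phi> x\<bar> \<le> M" "\<And>x. x \<in> \<Omega> \<Longrightarrow> norm (D x) \<le> M"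
      using tf by (auto simp: test_function_def)
    have c\<phi>: "continuous_on \<Omega> \<phi>"
      using d\<phi> by (meson continuous_at_imp_continuous_on has_derivative_continuous)
    \<comment> \<open>\<open>k n\<close> is the reciprocal of the width \<open>c / (n + 1)\<close> of the layer on which the cutoff increases.\<close>
    define k where "k n = real (Suc n) / c" for n
    have k: "k n > 0" for n using c by (simp add: k_def)
    define \<eta> where "\<eta> n x = h (- k n * \<rho> x - 1)" for n x
    define D\<eta> where "D\<eta> n x = (- k n * h' (- k n * \<rho> x - 1)) *\<^sub>R grad \<rho> x" for n x
    \<comment> \<open>\<open>A n + B n\<close> is the divergence of the cut-off field: \<open>A n\<close> converges to the integrand, \<open>B n\<close> contains the gradient of the cutoff.\<close>
    define A where "A n x = indicator V x * (\<eta> n x * (D x \<bullet> G x))" for n x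
    define B where "B n x = indicator V x * (\<phi> x * (D\<eta> n x \<bullet> G x))" for n x
    have d\<eta>: "(\<eta> n has_derivative (\<lambda>v. D\<eta> n x \<bullet> v)) (at x)" if "x \<in> V" for n x
    proof -
      have d1: "((\<lambda>x. - k n * \<rho> x - 1) has_derivative (\<lambda>v. - k n * (grad \<rho> x \<bullet> v))) (at x)"
        using that R(3) by (auto simp: V_def intro!: derivative_eq_intros has_derivative_grad)
      have "(h has_derivative (\<lambda>v. h' (- k n * \<rho> x - 1) * v)) (at (- k n * \<rho> x - 1))"
        using h(1) by (simp add: has_field_derivative_def)
      from has_derivative_compose[OF d1 this] show ?thesis
        unfolding \<eta>_def D\<eta>_def by (simp add: mult_ac)
    qed
    have c\<eta>: "continuous_on V (\<eta> n)" for n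
      using d\<eta> by (meson continuous_at_imp_continuous_on has_derivative_continuous)
    have c\<rho>: "continuous_on V \<rho>" "continuous_on V (grad \<rho>)"
      using R(5,7) by (auto simp: V_def intro: continuous_on_subset)
    have cD\<eta>: "continuous_on V (D\<eta> n)" for n
      unfolding D\<eta>_def by (intro continuous_intros continuous_on_compose2[OF h(2)] c\<rho>) auto
    have cV: "continuous_on V \<phi>" "continuous_on V D" "continuous_on V G" "\<And>v. continuous_on V (\<lambda>x. H x v)"
      using c\<phi> cD cG cont by (auto simp: V_def intro: continuous_on_subset)
    \<comment> \<open>The components of the cut-off field.\<close>
    define f where "f n i x = \<eta> n x * \<phi> x * (G x $ i)" for n i x
    define f' where "f' n i x v = \<eta> n x * \<phi> x * (H x v $ i)
        + ((\<eta> n x *\<^sub>R D x + \<phi> x *\<^sub>R D\<eta> n x) \<bullet> v) * (G x $ i)" for n i x v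
    have df: "(f n i has_derivative f' n i x) (at x)" if "x \<in> V" for n i x
    proof -
      have "x \<in> \<Omega>" using that by (simp add: V_def)
      have "((\<lambda>x. G x $ i) has_derivative (\<lambda>v. H x v $ i)) (at x)"
        by (rule bounded_linear.has_derivative[OF bounded_linear_vec_nth der[OF \<open>x \<in> \<Omega>\<close>]])
      from has_derivative_mult[OF has_derivative_mult[OF d\<eta>[OF that] d\<phi>[OF \<open>x \<in> \<Omega>\<close>]] this]
      have "(f n i has_derivative (\<lambda>v. \<eta> n x * \<phi> x * (H x v $ i)
          + (\<eta> n x * (D x \<bullet> v) + (D\<eta> n x \<bullet> v) * \<phi> x) * (G x $ i))) (at x)"
        unfolding f_def .
      then show ?thesis unfolding f'_def by (simp add: inner_add_left algebra_simps)
    qed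
    define K where "K n = {x \<in> cball p r. \<rho> x \<le> - (1 / k n)}" for n
    have K: "compact (K n)" "K n \<subseteq> V" for n
    proof -
      have "closed {x \<in> cball p r. \<rho> x \<in> {.. - (1 / k n)}}"
        using continuous_closed_preimage[OF continuous_on_subset[OF R(7) r(2)] closed_cball closed_atMost]
        by (simp add: vimage_def Int_def)
      then have "compact (cball p r \<inter> {x \<in> cball p r. \<rho> x \<in> {.. - (1 / k n)}})"
        by (intro compact_Int_closed) auto
      also have "cball p r \<inter> {x \<in> cball p r. \<rho> x \<in> {.. - (1 / k n)}} = K n" by (auto simp: K_def)
      finally show "compact (K n)" .
      show "K n \<subseteq> V"
      proof
        fix x assume x: "x \<in> K n"
        then have "x \<in> U" using r(2) by (auto simp: K_def)
        moreover have "\<rho> x < 0"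
          using x k[of n] by (auto simp: K_def intro: le_less_trans)
        ultimately show "x \<in> V" using R(6) by (simp add: V_def)
      qed
    qed
    have f0: "f n i x = 0" if "x \<in> V - K n" for n i x
    proof (cases "x \<in> cball p r")
      case True
      with that have "\<rho> x > - (1 / k n)" by (auto simp: K_def)
      then have "- k n * \<rho> x - 1 \<le> 0" using k[of n] by (simp add: field_simps)
      then show ?thesis using h(3) by (simp add: f_def \<eta>_def)
    next
      case False
      then show ?thesis using that out by (simp add: f_def V_def)
    qed
    have cf': "continuous_on V (\<lambda>x. f' n i x v)" for n i v
      unfolding f'_def by (intro continuous_intros c\<eta> cV cD\<eta>)
    note int = integral_directional_derivative[OF V K df cf' f0]
    have sum: "(\<Sum>i\<in>UNIV. indicator V x * f' n i x (axis i 1)) = A n x + B n x" for n x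
    proof (cases "x \<in> V")
      case True
      then have "x \<in> \<Omega>" by (simp add: V_def)
      have "(\<Sum>i\<in>UNIV. f' n i x (axis i 1))
          = \<eta> n x * \<phi> x * trace (matrix (H x)) + (\<eta> n x *\<^sub>R D x + \<phi> x *\<^sub>R D\<eta> n x) \<bullet> G x"
        unfolding inner_vec_def[of _ "G x"]
        by (simp add: f'_def sum.distrib trace_def matrix_def inner_axis sum_distrib_left)
      then show ?thesis using True div[OF \<open>x \<in> \<Omega>\<close>] by (simp add: A_def B_def inner_add_left)
    qed (simp add: A_def B_def)
    have intAB: "integrable lborel (\<lambda>x. A n x + B n x)" for n
      unfolding sum[symmetric] using int(1)[of n] by (intro Bochner_Integration.integrable_sum)
    have AB0: "(\<integral>x. A n x + B n x \<partial>lborel) = 0" for n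
      unfolding sum[symmetric] using int[of n] by (subst Bochner_Integration.integral_sum) auto
    \<comment> \<open>The layer outside of which the derivative of the cutoff vanishes.\<close>
    define L where "L n = {x \<in> cball p r. - (2 / k n) \<le> \<rho> x \<and> \<rho> x \<le> - (1 / k n)}" for n
    have measA: "A n \<in> borel_measurable lborel" for n
    proof -
      have "continuous_on V (\<lambda>x. \<eta> n x * (D x \<bullet> G x))" by (intro continuous_intros c\<eta> cV)
      from borel_measurable_continuous_on_indicator[OF borel_open[OF V] this]
      show ?thesis by (simp add: A_def[abs_def])
    qed
    have measA0: "(\<lambda>x. indicator V x * (D x \<bullet> G x)) \<in> borel_measurable lborel"
    proof -
      have "continuous_on V (\<lambda>x. D x \<bullet> G x)" by (intro continuous_intros cV)
      from borel_measurable_continuous_on_indicator[OF borel_open[OF V] this]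
      show ?thesis by simp
    qed
    have DG: "\<bar>D x \<bullet> G x\<bar> \<le> \<bar>M * MG\<bar>" if "x \<in> \<Omega>" for x
    proof -
      have "\<bar>D x \<bullet> G x\<bar> \<le> norm (D x) * norm (G x)" by (rule Cauchy_Schwarz_ineq2)
      also have "\<dots> \<le> M * MG"
        using M(2)[OF that] bnd[OF that] by (intro mult_mono) (auto intro: order_trans[OF norm_ge_zero])
      also have "\<dots> \<le> \<bar>M * MG\<bar>" by simp
      finally show ?thesis .
    qed
    have wint: "integrable lborel (\<lambda>x. indicator (cball p r) x * \<bar>M * MG\<bar>)"
      by (auto intro!: integrable_mult_left emeasure_compact_finite)
    have limA: "AE x in lborel. (\<lambda>n. A n x) \<longlonglongrightarrow> indicator V x * (D x \<bullet> G x)"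
    proof (rule AE_I2)
      fix x
      show "(\<lambda>n. A n x) \<longlonglongrightarrow> indicator V x * (D x \<bullet> G x)"
      proof (cases "x \<in> V")
        case True
        then have "\<rho> x < 0" using R(6)[of x] by (simp add: V_def)
        obtain N where N: "real N > 2 * c / (- \<rho> x)" using reals_Archimedean2 by blast
        have "\<eta> n x = 1" if "n \<ge> N" for n
        proof -
          have "real (Suc n) > 2 * c / (- \<rho> x)" using N that by linarith
          then have "- k n * \<rho> x - 1 \<ge> 1" using \<open>\<rho> x < 0\<close> c by (simp add: k_def field_simps)
          then show ?thesis using h(4) by (simp add: \<eta>_def)
        qed
        then have "\<forall>\<^sub>F n in sequentially. A n x = indicator V x * (D x \<bullet> G x)"
          unfolding eventually_sequentially A_def by auto
        then show ?thesis by (rule tendsto_eventually)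
      qed (simp add: A_def)
    qed
    have bndA: "AE x in lborel. norm (A n x) \<le> indicator (cball p r) x * \<bar>M * MG\<bar>" for n
    proof (rule AE_I2)
      fix x
      show "norm (A n x) \<le> indicator (cball p r) x * \<bar>M * MG\<bar>"
      proof (cases "x \<in> V \<inter> cball p r")
        case True
        have "\<bar>\<eta> n x\<bar> * \<bar>D x \<bullet> G x\<bar> \<le> 1 * \<bar>M * MG\<bar>"
          using h(5)[of "- k n * \<rho> x - 1"] DG[of x] True
          by (intro mult_mono) (auto simp: \<eta>_def V_def)
        then show ?thesis using True by (simp add: A_def abs_mult)
      next
        case False
        then show ?thesis
          using out[of x] DG[of x] by (auto simp: A_def V_def indicator_def)
      qed
    qed
    note dom = integrable_dominated_convergence2[OF measA0 measA wint limA bndA]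
      integral_dominated_convergence[OF measA0 measA wint limA bndA]
    have intB: "integrable lborel (B n)" for n
      using Bochner_Integration.integrable_diff[OF intAB[of n] dom(1)[of n]] by simp
    have AB: "(\<integral>x. A n x \<partial>lborel) = - (\<integral>x. B n x \<partial>lborel)" for n
      using AB0[of n] dom(1)[of n] intB[of n] by simp
    have limB: "(\<lambda>n. \<integral>x. B n x \<partial>lborel) \<longlonglongrightarrow> 0"
    proof (rule LIMSEQ_I)
      fix \<epsilon>' :: real assume "\<epsilon>' > 0"
      \<comment> \<open>The layer has measure at most \<open>V0 / (n + 1)\<close>, which balances the size \<open>k n\<close> of the gradient of the cutoff; the summand \<open>1\<close> makes \<open>Q\<close> positive.\<close>
      define Q where "Q = \<bar>M\<bar> * (C / c) * V0 + 1"
      have V0: "V0 \<ge> 0" by (simp add: V0_def)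
      have Q: "Q > 0" using V0 c h(8) unfolding Q_def by (intro add_nonneg_pos mult_nonneg_nonneg) auto
      define \<epsilon> where "\<epsilon> = \<epsilon>' / Q"
      have \<epsilon>: "\<epsilon> > 0" using \<open>\<epsilon>' > 0\<close> Q by (simp add: \<epsilon>_def)
      obtain \<delta> where \<delta>: "\<delta> > 0" "\<And>x. x \<in> \<Omega> \<inter> cball p r \<Longrightarrow> - \<delta> \<le> \<rho> x \<Longrightarrow> \<bar>G x \<bullet> grad \<rho> x\<bar> < \<epsilon>"
        using small_near_zero_level[OF \<Omega> \<rho> r(2) flux \<epsilon>] by blast
      obtain N where N: "real N > 2 * c / \<delta>" using reals_Archimedean2 by blast
      have "norm ((\<integral>x. B n x \<partial>lborel) - 0) < \<epsilon>'" if n: "n \<ge> N" for n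
      proof -
        have "real (Suc n) > 2 * c / \<delta>" using N n by linarith
        then have kd: "2 / k n < \<delta>" using \<delta>(1) c by (simp add: k_def field_simps)
        define b where "b = \<bar>M\<bar> * (k n * C * \<epsilon>)"
        have b0: "b \<ge> 0" unfolding b_def using k[of n] h(8) \<epsilon> by simp
        have Lm: "compact (L n)"
        proof -
          have "closed {x \<in> cball p r. \<rho> x \<in> {- (2 / k n) .. - (1 / k n)}}"
            using continuous_closed_preimage[OF continuous_on_subset[OF R(7) r(2)] closed_cball closed_atLeastAtMost]
            by (simp add: vimage_def Int_def)
          then have "compact (cball p r \<inter> {x \<in> cball p r. \<rho> x \<in> {- (2 / k n) .. - (1 / k n)}})"
            by (intro compact_Int_closed) auto
          also have "cball p r \<inter> {x \<in> cball p r. \<rho> x \<in> {- (2 / k n) .. - (1 / k n)}} = L n"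
            by (auto simp: L_def)
          finally show ?thesis .
        qed
        have Bb: "norm (B n x) \<le> indicator (L n) x * b" for x
        proof (cases "x \<in> V \<inter> cball p r \<and> h' (- k n * \<rho> x - 1) \<noteq> 0")
          case True
          then have x: "x \<in> \<Omega>" "x \<in> cball p r" by (auto simp: V_def)
          have "0 < - k n * \<rho> x - 1" "- k n * \<rho> x - 1 < 1"
            using True h(6)[of "- k n * \<rho> x - 1"] by (meson not_le)+
          then have l: "- (2 / k n) \<le> \<rho> x" "\<rho> x \<le> - (1 / k n)" using k[of n] by (simp_all add: field_simps)
          then have "x \<in> L n" using x by (simp add: L_def)
          have g: "\<bar>G x \<bullet> grad \<rho> x\<bar> \<le> \<epsilon>" using \<delta>(2)[of x] x l kd by force
          have "norm (B n x) = \<bar>\<phi> x\<bar> * (k n * \<bar>h' (- k n * \<rho> x - 1)\<bar> * \<bar>G x \<bullet> grad \<rho> x\<bar>)"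
            using True k[of n] by (simp add: B_def D\<eta>_def abs_mult inner_commute)
          also have "\<dots> \<le> \<bar>M\<bar> * (k n * C * \<epsilon>)"
            using M(1)[OF x(1)] k[of n] h(7,8) g \<epsilon> by (intro mult_mono) auto
          finally show ?thesis using \<open>x \<in> L n\<close> by (simp add: b_def)
        next
          case False
          then have "B n x = 0" using out[of x] by (auto simp: B_def D\<eta>_def V_def indicator_def)
          then show ?thesis using b0 by simp
        qed
        have "norm (\<integral>x. B n x \<partial>lborel) \<le> (\<integral>x. indicator (L n) x * b \<partial>lborel)"
        proof (rule Bochner_Integration.integral_norm_bound_integral)
          show "integrable lborel (\<lambda>x. indicator (L n) x * b)"
            using Lm by (auto intro!: integrable_mult_left emeasure_compact_finite borel_compact)
        qed (use intB Bb in auto)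
        also have "\<dots> = measure lborel (L n) * b"
          using Lm by (simp add: borel_compact)
        also have "\<dots> \<le> V0 / real (Suc n) * b"
        proof (rule mult_right_mono[OF _ b0])
          show "measure lborel (L n) \<le> V0 / real (Suc n)"
            unfolding L_def V0_def
          proof (rule measure_thin_layer[OF r(2) R(7) _ c])
            show "(\<rho> has_derivative (\<lambda>h. grad \<rho> x \<bullet> h)) (at x)" if "x \<in> cball p r" for x
              using that r(2) by (intro has_derivative_grad R(3)) auto
            show "- (1 / k n) - - (2 / k n) \<le> c / real (Suc n)" using c by (simp add: k_def)
          qed (use c' in auto)
        qed
        also have "\<dots> = \<bar>M\<bar> * (C / c) * V0 * \<epsilon>"
          unfolding b_def k_def by (simp del: of_nat_Suc)
        also have "\<dots> < Q * \<epsilon>" unfolding Q_def using \<epsilon> by (simp add: distrib_right)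
        also have "Q * \<epsilon> = \<epsilon>'" using Q by (simp add: \<epsilon>_def)
        finally show ?thesis by simp
      qed
      then show "\<exists>N. \<forall>n\<ge>N. norm ((\<integral>x. B n x \<partial>lborel) - 0) < \<epsilon>'" by blast
    qed
    have "(\<lambda>n. \<integral>x. A n x \<partial>lborel) \<longlonglongrightarrow> - 0"
      unfolding AB by (intro tendsto_minus limB)
    with dom(2) have "(\<integral>x. indicator V x * (D x \<bullet> G x) \<partial>lborel) = 0"
      by (simp add: LIMSEQ_unique)
    moreover have "indicator V x * (D x \<bullet> G x) = indicator \<Omega> x * (D x \<bullet> G x)" for x
    proof (cases "x \<in> \<Omega> - U")
      case True
      then have "x \<in> \<Omega> - cball p r" using r(2) by blast
      from out[OF this] show ?thesis by simp
    qed (auto simp: V_def indicator_def)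
    ultimately show ?thesis by simp
  qed
  show ?thesis by (rule that[OF r(1) main])
qed

text \<open>
  The limits bound the function near each point of the closure, and the closure is compact.
\<close>

lemma bounded_of_boundary_limits:
  fixes f :: "'a::euclidean_space \<Rightarrow> 'b::real_normed_vector"
  assumes "bounded \<Omega>" and "open \<Omega>" and cont: "continuous_on \<Omega> f"
    and lim: "\<And>x. x \<in> frontier \<Omega> \<Longrightarrow> \<exists>l. (f \<longlongrightarrow> l) (at x within \<Omega>)"
  shows "\<exists>M. \<forall>x\<in>\<Omega>. norm (f x) \<le> M"
proof -
  have "\<exists>d M. 0 < d \<and> (\<forall>y \<in> \<Omega> \<inter> ball x d. norm (f y) \<le> M)" if "x \<in> closure \<Omega>" for x
  proof -
    have "\<exists>l. (f \<longlongrightarrow> l) (at x within \<Omega>)"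
      using that lim[of x] cont \<open>open \<Omega>\<close>
      by (cases "x \<in> \<Omega>") (auto simp: continuous_on_def frontier_def interior_open)
    then obtain l where "(f \<longlongrightarrow> l) (at x within \<Omega>)" ..
    then have "\<forall>\<^sub>F y in at x within \<Omega>. norm (f y) < norm l + 1"
      by (intro order_tendstoD(2)[OF tendsto_norm]) auto
    then obtain d where d: "d > 0" "\<And>y. y \<in> \<Omega> \<Longrightarrow> y \<noteq> x \<Longrightarrow> dist y x < d \<Longrightarrow> norm (f y) < norm l + 1"
      unfolding eventually_at by auto
    have "norm (f y) \<le> max (norm l + 1) (norm (f x))" if "y \<in> \<Omega> \<inter> ball x d" for y
      using d(2)[of y] that by (cases "y = x") (auto simp: dist_commute)
    with d(1) show ?thesis by blast
  qed
  then obtain d M where dM: "\<And>x. x \<in> closure \<Omega> \<Longrightarrow> 0 < d x"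
    "\<And>x y. x \<in> closure \<Omega> \<Longrightarrow> y \<in> \<Omega> \<inter> ball x (d x) \<Longrightarrow> norm (f y) \<le> M x"
    by metis
  have K: "compact (closure \<Omega>)" using \<open>bounded \<Omega>\<close> by simp
  have "closure \<Omega> \<subseteq> (\<Union>x\<in>closure \<Omega>. ball x (d x))" using dM(1) by force
  then obtain T where T: "T \<subseteq> closure \<Omega>" "finite T" "closure \<Omega> \<subseteq> (\<Union>x\<in>T. ball x (d x))"
    by (rule compactE_image[OF K, of "closure \<Omega>" "\<lambda>x. ball x (d x)", rotated]) auto
  have "norm (f y) \<le> (\<Sum>x\<in>T. \<bar>M x\<bar>)" if y: "y \<in> \<Omega>" for y
  proof -
    obtain x where x: "x \<in> T" "y \<in> ball x (d x)" using T(3) y closure_subset by blast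
    then have "norm (f y) \<le> M x" using dM(2)[of x y] T(1) y by auto
    also have "\<dots> \<le> \<bar>M x\<bar>" by simp
    also have "\<dots> \<le> (\<Sum>x\<in>T. \<bar>M x\<bar>)" using x(1) T(2) by (intro member_le_sum) auto
    finally show ?thesis .
  qed
  then show ?thesis by blast
qed

text \<open>
  A defining function without zeros around \<open>p\<close>, so that interior points and boundary points can
  be treated alike.
\<close>

lemma interior_point_defining_function:
  fixes \<Omega> :: "(real^'d) set"
  assumes "open \<Omega>" "p \<in> \<Omega>"
  obtains U \<rho> where "C1_defining_function \<Omega> p U \<rho>" "U \<inter> frontier \<Omega> = {}"
proof -
  obtain d where d: "d > 0" "ball p d \<subseteq> \<Omega>" using assms open_contains_ball by blast
  obtain e :: "real^'d" where e: "norm e = 1" using vector_choose_size[of 1] by auto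
  define \<rho> where "\<rho> x = e \<bullet> (x - p) - d" for x
  have der: "(\<rho> has_derivative (\<lambda>h. e \<bullet> h)) (at x)" for x
    unfolding \<rho>_def by (auto intro!: derivative_eq_intros)
  then have g: "grad \<rho> x = e" for x by (rule grad_unique)
  have neg: "\<rho> x < 0" if "x \<in> ball p d" for x
    using Cauchy_Schwarz_ineq2[of e "x - p"] e that by (simp add: \<rho>_def dist_norm norm_minus_commute)
  have "C1_defining_function \<Omega> p (ball p d) \<rho>"
    unfolding C1_defining_function_def
    using d der neg e by (auto simp: g[abs_def] g differentiable_def)
  moreover have "ball p d \<inter> frontier \<Omega> = {}"
    using d assms(1) by (auto simp: frontier_def interior_open)
  ultimately show ?thesis by (rule that)
qed

text \<open>
  Bumps \<open>max 0 (r\<^sup>2 - |x - p|\<^sup>2)\<^sup>2\<close> divided by their sum. The quotients are differentiable wherever the sum is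
  positive, in particular on \<open>K\<close>.
\<close>

lemma C1_partition_of_unity:
  fixes K :: "(real^'d) set" and r :: "real^'d \<Rightarrow> real"
  assumes K: "compact K" and r: "\<And>p. p \<in> K \<Longrightarrow> 0 < r p"
  obtains T \<theta> D where "finite T" "T \<subseteq> K"
    "\<And>p x. x \<in> K \<Longrightarrow> (\<theta> p has_derivative (\<lambda>h. D p x \<bullet> h)) (at x)"
    "\<And>p. continuous_on K (\<theta> p)" "\<And>p. continuous_on K (D p)"
    "\<And>p x. x \<notin> cball p (r p) \<Longrightarrow> \<theta> p x = 0 \<and> D p x = 0"
    "\<And>x. x \<in> K \<Longrightarrow> (\<Sum>p\<in>T. \<theta> p x) = 1"
proof -
  have "K \<subseteq> (\<Union>p\<in>K. ball p (r p))" using r by force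
  then obtain T where T: "T \<subseteq> K" "finite T" "K \<subseteq> (\<Union>p\<in>T. ball p (r p))"
    by (rule compactE_image[OF K, of K "\<lambda>p. ball p (r p)", rotated]) auto
  \<comment> \<open>Setting \<open>q\<close> to zero for \<open>r p \<le> 0\<close> makes the claims hold for every index \<open>p\<close>; such \<open>p\<close> do not occur in \<open>T\<close>.\<close>
  define q where "q p x = (if 0 < r p then (r p)\<^sup>2 - (x - p) \<bullet> (x - p) else 0)" for p x :: "real^'d"
  define b where "b p x = (max 0 (q p x))\<^sup>2" for p x
  define Db where "Db p x = (if 0 < r p then (- 4 * max 0 (q p x)) *\<^sub>R (x - p) else 0)" for p x
  define S where "S x = (\<Sum>p\<in>T. b p x)" for x
  define DS where "DS x = (\<Sum>p\<in>T. Db p x)" for x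
  have q_out: "q p x \<le> 0" if "x \<notin> cball p (r p)" for p x
  proof -
    have "r p < norm (x - p)" using that by (simp add: dist_norm norm_minus_commute)
    then have "(r p)\<^sup>2 \<le> (norm (x - p))\<^sup>2" if "0 < r p" using that by (intro power_mono) auto
    then show ?thesis by (simp add: q_def dot_square_norm)
  qed
  have cq: "continuous_on A (q p)" for A p
    by (cases "0 < r p") (auto simp: q_def[abs_def] intro!: continuous_intros)
  have cb: "continuous_on A (b p)" for A p unfolding b_def by (intro continuous_intros cq)
  have cDb: "continuous_on A (Db p)" for A p
    by (cases "0 < r p") (auto simp: Db_def[abs_def] intro!: continuous_intros cq)
  have db: "(b p has_derivative (\<lambda>h. Db p x \<bullet> h)) (at x)" for p x
  proof (cases "0 < r p")
    case True
    have d1: "(q p has_derivative (\<lambda>h. - 2 * ((x - p) \<bullet> h))) (at x)"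
      using True unfolding q_def by (auto intro!: derivative_eq_intros simp: inner_commute)
    have d2: "((\<lambda>t::real. (max 0 t)\<^sup>2) has_derivative (\<lambda>v. 2 * max 0 (q p x) * v)) (at (q p x))"
      using DERIV_pos_part_square by (simp add: has_field_derivative_def)
    from has_derivative_compose[OF d1 d2] show ?thesis
      using True by (simp add: b_def[abs_def] Db_def mult_ac)
  next
    case False
    then show ?thesis by (simp add: b_def[abs_def] q_def Db_def)
  qed
  have dS: "(S has_derivative (\<lambda>h. DS x \<bullet> h)) (at x)" for x
    unfolding S_def DS_def inner_sum_left by (intro has_derivative_sum db)
  have b0: "b p x \<ge> 0" for p x by (simp add: b_def)
  have Spos: "S x > 0" if x: "x \<in> K" for x
  proof -
    obtain p where p: "p \<in> T" "x \<in> ball p (r p)" using T(3) x by blast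
    then have rp: "0 < r p" using r T(1) by blast
    have "norm (x - p) < r p" using p(2) by (simp add: dist_norm norm_minus_commute)
    then have "(norm (x - p))\<^sup>2 < (r p)\<^sup>2" by (intro power_strict_mono) auto
    then have "q p x > 0" using rp by (simp add: q_def dot_square_norm)
    then have "b p x > 0" by (simp add: b_def max_def)
    then show ?thesis unfolding S_def using p(1) T(2) b0 by (intro sum_pos2) auto
  qed
  have cS: "continuous_on K S" "continuous_on K DS"
    unfolding S_def DS_def by (intro continuous_intros cb cDb)+
  define \<theta> where "\<theta> p x = b p x / S x" for p x
  define D where "D p x = (1 / S x) *\<^sub>R Db p x - (b p x / (S x)\<^sup>2) *\<^sub>R DS x" for p x
  show ?thesis
  proof (rule that[OF T(2,1)])
    fix p
    have Sne: "\<forall>x\<in>K. S x \<noteq> 0" using Spos by force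
    show "continuous_on K (\<theta> p)"
      unfolding \<theta>_def by (intro continuous_intros cb cS Sne)
    show "continuous_on K (D p)"
      unfolding D_def using Sne by (intro continuous_intros cb cDb cS) auto
    show "(\<theta> p has_derivative (\<lambda>h. D p x \<bullet> h)) (at x)" if "x \<in> K" for x
    proof -
      have "S x \<noteq> 0" using Spos[OF that] by simp
      from has_derivative_divide'[OF db dS this] show ?thesis
        unfolding \<theta>_def D_def
        by (rule has_derivative_eq_rhs)
          (use \<open>S x \<noteq> 0\<close> in \<open>auto simp: inner_diff_left field_simps power2_eq_square fun_eq_iff\<close>)
    qed
    show "\<theta> p x = 0 \<and> D p x = 0" if "x \<notin> cball p (r p)" for x
      using q_out[OF that] by (auto simp: \<theta>_def D_def b_def Db_def)
  next
    fix x assume "x \<in> K"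
    then show "(\<Sum>p\<in>T. \<theta> p x) = 1"
      using Spos[of x] by (simp add: \<theta>_def S_def flip: sum_divide_distrib)
  qed
qed

text \<open>
  Local Green identities are summed with a partition of unity to \<open>\<integral> |G|\<^sup>2 = 0\<close>, where \<open>G\<close> is the gradient of
  \<open>w\<close>: for the test function \<open>w\<close> itself the boundary term and the Laplacian both vanish.
\<close>

lemma neumann_constant:
  fixes w :: "real^'d \<Rightarrow> real"
  assumes \<Omega>: "open \<Omega>" "connected \<Omega>" "bounded \<Omega>" "C1_boundary \<Omega>"
    and dw: "\<And>x. x \<in> \<Omega> \<Longrightarrow> (w has_derivative (\<lambda>h. G x \<bullet> h)) (at x)"
    and dG: "\<And>x. x \<in> \<Omega> \<Longrightarrow> (G has_derivative H x) (at x)"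
    and cH: "\<And>v. continuous_on \<Omega> (\<lambda>x. H x v)"
    and harmonic: "\<And>x. x \<in> \<Omega> \<Longrightarrow> trace (matrix (H x)) = 0"
    and lim_w: "\<And>x. x \<in> frontier \<Omega> \<Longrightarrow> \<exists>l. (w \<longlongrightarrow> l) (at x within \<Omega>)"
    and lim_G: "\<And>x. x \<in> frontier \<Omega> \<Longrightarrow>
      \<exists>g. (G \<longlongrightarrow> g) (at x within \<Omega>) \<and> outward_normal \<Omega> x \<bullet> g = 0"
  shows "\<exists>k. \<forall>x\<in>\<Omega>. w x = k"
proof -
  have cw: "continuous_on \<Omega> w"
    using dw by (meson continuous_at_imp_continuous_on has_derivative_continuous)
  have cG: "continuous_on \<Omega> G"
    using dG by (meson continuous_at_imp_continuous_on has_derivative_continuous)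
  have "\<exists>M. \<forall>x\<in>\<Omega>. norm (w x) \<le> M"
    by (rule bounded_of_boundary_limits[OF \<Omega>(3,1) cw lim_w])
  then obtain Mw where Mw: "\<And>x. x \<in> \<Omega> \<Longrightarrow> norm (w x) \<le> Mw" by blast
  have lim_G': "\<exists>g. (G \<longlongrightarrow> g) (at x within \<Omega>)" if "x \<in> frontier \<Omega>" for x
    using lim_G[OF that] by blast
  have "\<exists>M. \<forall>x\<in>\<Omega>. norm (G x) \<le> M"
    by (rule bounded_of_boundary_limits[OF \<Omega>(3,1) cG lim_G'])
  then obtain MG where MG: "\<And>x. x \<in> \<Omega> \<Longrightarrow> norm (G x) \<le> MG" by blast
  define green where "green p r \<longleftrightarrow> (\<forall>\<phi> D. test_function \<Omega> \<phi> D \<and> (\<forall>x\<in>\<Omega> - cball p r. \<phi> x = 0 \<and> D x = 0)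
     \<longrightarrow> (\<integral>x. indicator \<Omega> x * (D x \<bullet> G x) \<partial>lborel) = 0)" for p r
  have "\<exists>r>0. green p r" if p: "p \<in> closure \<Omega>" for p
  proof -
    have "\<exists>U \<rho>. C1_defining_function \<Omega> p U \<rho>
        \<and> (\<forall>x \<in> U \<inter> frontier \<Omega>. ((\<lambda>y. G y \<bullet> grad \<rho> y) \<longlongrightarrow> 0) (at x within \<Omega>))"
    proof (cases "p \<in> \<Omega>")
      case True
      obtain U \<rho> where "C1_defining_function \<Omega> p U \<rho>" "U \<inter> frontier \<Omega> = {}"
        by (rule interior_point_defining_function[OF \<Omega>(1) True])
      then show ?thesis by (metis empty_iff)
    next
      case False
      then have "p \<in> frontier \<Omega>" using p \<Omega>(1) by (simp add: frontier_def interior_open)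
      then obtain U \<rho> where \<rho>: "C1_defining_function \<Omega> p U \<rho>"
        using \<Omega>(4) by (auto simp: C1_boundary_def)
      note R = C1_defining_functionD[OF \<rho>]
      have "((\<lambda>y. G y \<bullet> grad \<rho> y) \<longlongrightarrow> 0) (at x within \<Omega>)" if x: "x \<in> U \<inter> frontier \<Omega>" for x
      proof -
        obtain g where g: "(G \<longlongrightarrow> g) (at x within \<Omega>)" "outward_normal \<Omega> x \<bullet> g = 0"
          using lim_G x by blast
        have "C1_defining_function \<Omega> x U \<rho>"
          using \<rho> x by (simp add: C1_defining_function_def)
        from outward_normal_eq[OF this \<Omega>(1)] x g(2) R(4)[of x]
        have "g \<bullet> grad \<rho> x = 0" by (simp add: inner_commute)
        moreover have "(grad \<rho> \<longlongrightarrow> grad \<rho> x) (at x within \<Omega>)"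
          using R(1,5) x by (intro tendsto_within_subset[OF isContD])
            (auto simp: continuous_on_eq_continuous_at isCont_def)
        ultimately show ?thesis using tendsto_inner[OF g(1)] by metis
      qed
      with \<rho> show ?thesis by blast
    qed
    then obtain U \<rho> where \<rho>: "C1_defining_function \<Omega> p U \<rho>"
      "\<And>x. x \<in> U \<inter> frontier \<Omega> \<Longrightarrow> ((\<lambda>y. G y \<bullet> grad \<rho> y) \<longlongrightarrow> 0) (at x within \<Omega>)" by blast
    show ?thesis
      by (rule local_green[OF \<Omega>(1) \<rho>(1) dG cH harmonic MG \<rho>(2)]) (auto simp: green_def)
  qed
  then obtain r where r: "\<And>p. p \<in> closure \<Omega> \<Longrightarrow> 0 < r p" "\<And>p. p \<in> closure \<Omega> \<Longrightarrow> green p (r p)"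
    by metis
  have K: "compact (closure \<Omega>)" using \<Omega>(3) by simp
  obtain T \<theta> D where T: "finite T" "T \<subseteq> closure \<Omega>"
    and d\<theta>: "\<And>p x. x \<in> closure \<Omega> \<Longrightarrow> (\<theta> p has_derivative (\<lambda>h. D p x \<bullet> h)) (at x)"
    and c\<theta>: "\<And>p. continuous_on (closure \<Omega>) (\<theta> p)" "\<And>p. continuous_on (closure \<Omega>) (D p)"
    and out: "\<And>p x. x \<notin> cball p (r p) \<Longrightarrow> \<theta> p x = 0 \<and> D p x = 0"
    and one: "\<And>x. x \<in> closure \<Omega> \<Longrightarrow> (\<Sum>p\<in>T. \<theta> p x) = 1"
    by (rule C1_partition_of_unity[OF K, of r]) (rule r(1) that; assumption)+
  have sub: "\<Omega> \<subseteq> closure \<Omega>" by (rule closure_subset)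
  \<comment> \<open>The gradient of the piece \<open>w \<theta>\<^sub>p\<close> of \<open>w\<close>.\<close>
  define E where "E p x = w x *\<^sub>R D p x + \<theta> p x *\<^sub>R G x" for p x
  have dE: "((\<lambda>x. w x * \<theta> p x) has_derivative (\<lambda>h. E p x \<bullet> h)) (at x)" if "x \<in> \<Omega>" for p x
    using has_derivative_mult[OF dw[OF that] d\<theta>[OF subsetD[OF sub that]]]
    by (rule has_derivative_eq_rhs) (simp add: E_def inner_add_left algebra_simps fun_eq_iff)
  have cE: "continuous_on \<Omega> (E p)" for p
    unfolding E_def by (intro continuous_intros cw cG continuous_on_subset[OF c\<theta>(1) sub] continuous_on_subset[OF c\<theta>(2) sub])
  have bE: "\<exists>M. \<forall>x\<in>\<Omega>. \<bar>w x * \<theta> p x\<bar> \<le> M \<and> norm (E p x) \<le> M" for p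
  proof -
    have "bounded (\<theta> p ` closure \<Omega>)" "bounded (D p ` closure \<Omega>)"
      by (intro compact_imp_bounded compact_continuous_image c\<theta> K)+
    then obtain a b where a: "\<And>x. x \<in> closure \<Omega> \<Longrightarrow> norm (\<theta> p x) \<le> a"
      and b: "\<And>x. x \<in> closure \<Omega> \<Longrightarrow> norm (D p x) \<le> b"
      unfolding bounded_iff by blast
    have "\<bar>w x * \<theta> p x\<bar> \<le> max (Mw * a) (Mw * b + a * MG) \<and> norm (E p x) \<le> max (Mw * a) (Mw * b + a * MG)"
      if x: "x \<in> \<Omega>" for x
    proof -
      have x': "x \<in> closure \<Omega>" using x sub by blast
      have 1: "norm (w x) * norm (\<theta> p x) \<le> Mw * a"
        using Mw[OF x] a[OF x'] by (intro mult_mono) (auto intro: order_trans[OF norm_ge_zero])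
      have 2: "norm (w x) * norm (D p x) \<le> Mw * b"
        using Mw[OF x] b[OF x'] by (intro mult_mono) (auto intro: order_trans[OF norm_ge_zero])
      have 3: "norm (\<theta> p x) * norm (G x) \<le> a * MG"
        using MG[OF x] a[OF x'] by (intro mult_mono) (auto intro: order_trans[OF norm_ge_zero])
      have "norm (E p x) \<le> norm (w x) * norm (D p x) + norm (\<theta> p x) * norm (G x)"
        unfolding E_def by (rule order_trans[OF norm_triangle_ineq]) simp
      with 2 3 have "norm (E p x) \<le> Mw * b + a * MG" by linarith
      with 1 show ?thesis by (simp add: abs_mult le_max_iff_disj)
    qed
    then show ?thesis by blast
  qed
  have tf: "test_function \<Omega> (\<lambda>x. w x * \<theta> p x) (E p)" for p
    unfolding test_function_def using dE cE bE by blast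
  have zero: "(\<integral>x. indicator \<Omega> x * (E p x \<bullet> G x) \<partial>lborel) = 0" if "p \<in> T" for p
  proof -
    have "green p (r p)" using r(2) that T(2) by blast
    moreover have "\<forall>x\<in>\<Omega> - cball p (r p). w x * \<theta> p x = 0 \<and> E p x = 0"
      using out[of _ p] by (auto simp: E_def)
    ultimately show ?thesis using tf unfolding green_def by blast
  qed
  have int: "integrable lborel (\<lambda>x. indicator \<Omega> x * (E p x \<bullet> G x))" for p
  proof -
    obtain M where M: "\<And>x. x \<in> \<Omega> \<Longrightarrow> norm (E p x) \<le> M" using bE by blast
    have "continuous_on \<Omega> (\<lambda>x. E p x \<bullet> G x)" by (intro continuous_intros cE cG)
    from borel_measurable_continuous_on_indicator[OF borel_open[OF \<Omega>(1)] this]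
    have meas: "(\<lambda>x. indicator \<Omega> x * (E p x \<bullet> G x)) \<in> borel_measurable lborel" by simp
    show ?thesis
    proof (rule integrableI_bounded_set[OF _ meas, where A = \<Omega> and B = "M * MG"])
      show "AE x in lborel. x \<in> \<Omega> \<longrightarrow> norm (indicator \<Omega> x * (E p x \<bullet> G x)) \<le> M * MG"
      proof (rule AE_I2, rule impI)
        fix x assume x: "x \<in> \<Omega>"
        have "norm (E p x \<bullet> G x) \<le> norm (E p x) * norm (G x)"
          using Cauchy_Schwarz_ineq2 by simp
        also have "\<dots> \<le> M * MG"
          using M[OF x] MG[OF x] by (intro mult_mono) (auto intro: order_trans[OF norm_ge_zero])
        finally show "norm (indicator \<Omega> x * (E p x \<bullet> G x)) \<le> M * MG" using x by simp
      qed
    qed (use \<Omega> emeasure_bounded_finite in auto)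
  qed
  have sumE: "(\<Sum>p\<in>T. E p x) = G x" if x: "x \<in> \<Omega>" for x
  proof -
    have "((\<lambda>x. \<Sum>p\<in>T. w x * \<theta> p x) has_derivative (\<lambda>h. \<Sum>p\<in>T. E p x \<bullet> h)) (at x)"
      by (intro has_derivative_sum dE x)
    then have "(w has_derivative (\<lambda>h. \<Sum>p\<in>T. E p x \<bullet> h)) (at x)"
    proof (rule has_derivative_transform_within_open[OF _ \<Omega>(1) x])
      show "(\<Sum>p\<in>T. w y * \<theta> p y) = w y" if "y \<in> \<Omega>" for y
        using one[of y] that sub by (auto simp flip: sum_distrib_left)
    qed
    then have "grad w x = (\<Sum>p\<in>T. E p x)"
      by (intro grad_unique) (simp add: inner_sum_left)
    then show ?thesis using grad_unique[OF dw[OF x]] by simp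
  qed
  have eq: "(\<Sum>p\<in>T. indicator \<Omega> x * (E p x \<bullet> G x)) = indicator \<Omega> x * (G x \<bullet> G x)" for x
    using sumE[of x] by (cases "x \<in> \<Omega>") (auto simp flip: inner_sum_left)
  have energy_int: "integrable lborel (\<lambda>x. indicator \<Omega> x * (G x \<bullet> G x))"
    unfolding eq[symmetric] by (intro Bochner_Integration.integrable_sum int)
  have "(\<integral>x. indicator \<Omega> x * (G x \<bullet> G x) \<partial>lborel) = 0"
    unfolding eq[symmetric] using int zero by (subst Bochner_Integration.integral_sum) auto
  then have ae: "AE x in lborel. indicator \<Omega> x * (G x \<bullet> G x) = 0"
    using energy_int by (subst (asm) integral_nonneg_eq_0_iff_AE) auto
  have "G x = 0" if x: "x \<in> \<Omega>" for x
  proof (rule ccontr)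
    assume "G x \<noteq> 0"
    have "open {y \<in> \<Omega>. G y \<in> - {0}}"
      using continuous_open_preimage[OF cG \<Omega>(1) open_Compl[OF closed_singleton[of 0]]]
      by (simp add: vimage_def Int_def)
    moreover have "x \<in> {y \<in> \<Omega>. G y \<in> - {0}}" using x \<open>G x \<noteq> 0\<close> by simp
    ultimately obtain d where d: "d > 0" "ball x d \<subseteq> {y \<in> \<Omega>. G y \<in> - {0}}"
      using open_contains_ball by blast
    have "AE y in lborel. y \<notin> ball x d"
      using ae by eventually_elim (use d(2) in \<open>force simp: subset_iff\<close>)
    then have "emeasure lborel (ball x d) = 0"
      using AE_iff_measurable[of "ball x d" lborel "\<lambda>y. y \<notin> ball x d"]
      by (simp add: ball_def[symmetric])
    then show False using content_ball_pos[OF d(1), of x] by (simp add: measure_def)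
  qed
  then have "(w has_derivative (\<lambda>h. 0)) (at x)" if "x \<in> \<Omega>" for x
    using dw[OF that] that by simp
  from has_derivative_zero_unique_connected[OF \<Omega>(1,2) this] show ?thesis by blast
qed

section \<open>Positive definite matrices\<close>

lemma symmetric_matrix_inner:
  fixes B :: "real^'d^'d"
  assumes "transpose B = B"
  shows "x \<bullet> (B *v y) = (B *v x) \<bullet> y"
  by (metis assms dot_lmul_matrix transpose_matrix_vector)

lemma pos_defD:
  assumes "pos_def B"
  shows "transpose B = B" "\<And>x. x \<noteq> 0 \<Longrightarrow> 0 < x \<bullet> (B *v x)" "\<And>x. 0 \<le> x \<bullet> (B *v x)"
    "\<And>x. x \<bullet> (B *v x) \<le> 0 \<Longrightarrow> x = 0"
proof -
  show "transpose B = B" and *: "\<And>x. x \<noteq> 0 \<Longrightarrow> 0 < x \<bullet> (B *v x)" using assms by (auto simp: pos_def_def)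
  show "0 \<le> x \<bullet> (B *v x)" for x using *[of x] by (cases "x = 0") auto
  show "x = 0" if "x \<bullet> (B *v x) \<le> 0" for x using *[of x] that by linarith
qed

lemma pos_def_inj:
  assumes "pos_def B" "B *v x = B *v y"
  shows "x = y"
proof -
  have "(x - y) \<bullet> (B *v (x - y)) = 0" using assms(2) by (simp add: matrix_vector_mult_diff_distrib)
  then show ?thesis using pos_defD(4)[OF assms(1), of "x - y"] by simp
qed

lemma matrix_inv_unique:
  fixes A :: "real^'d^'d"
  assumes "A ** X = mat 1" "X ** A = mat 1"
  shows "matrix_inv A = X"
proof -
  have "A ** matrix_inv A = mat 1"
    using someI[of "\<lambda>X. A ** X = mat 1 \<and> X ** A = mat 1" X] assms by (auto simp: matrix_inv_def)
  then have "X ** (A ** matrix_inv A) = X" by simp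
  then show ?thesis unfolding matrix_mul_assoc assms(2) by simp
qed

lemma pos_def_matrix_inv:
  fixes A :: "real^'d^'d"
  assumes "pos_def A"
  shows "A ** matrix_inv A = mat 1" "matrix_inv A ** A = mat 1" "pos_def (matrix_inv A)"
    "A *v (matrix_inv A *v x) = x" "matrix_inv A *v (A *v x) = x"
proof -
  define X where "X = matrix_inv A"
  have "inj ((*v) A)" using pos_def_inj[OF assms] by (auto intro: injI)
  then have "invertible A" by (simp add: invertible_left_inverse matrix_left_invertible_injective)
  then obtain Y where Y: "A ** Y = mat 1" "Y ** A = mat 1" by (auto simp: invertible_def)
  then have X: "A ** X = mat 1" "X ** A = mat 1" using matrix_inv_unique[OF Y] by (auto simp: X_def)
  then show "A ** matrix_inv A = mat 1" "matrix_inv A ** A = mat 1" by (auto simp: X_def)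
  have AX: "A *v (X *v x) = x" for x by (simp add: matrix_vector_mul_assoc X)
  then show "A *v (matrix_inv A *v x) = x" by (simp add: X_def)
  show "matrix_inv A *v (A *v x) = x" by (simp add: matrix_vector_mul_assoc X X_def[symmetric])
  have "transpose X ** A = transpose (A ** X)"
    by (simp add: matrix_transpose_mul pos_defD(1)[OF assms])
  then have "transpose X ** A = mat 1" by (simp add: X transpose_mat)
  then have "transpose X ** A ** X = X" by simp
  then have "transpose X = X" by (simp add: X flip: matrix_mul_assoc)
  moreover have "0 < x \<bullet> (X *v x)" if "x \<noteq> 0" for x
  proof -
    have "X *v x \<noteq> 0" using AX[of x] that by auto
    then have "0 < (X *v x) \<bullet> (A *v (X *v x))" by (rule pos_defD(2)[OF assms])
    then show ?thesis by (simp add: AX inner_commute)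
  qed
  ultimately show "pos_def (matrix_inv A)" by (simp add: pos_def_def X_def)
qed

lemma matrix_vector_mult_mat: "mat k *v x = k *\<^sub>R (x :: real^'d)"
proof -
  have "mat k = k *\<^sub>R (mat 1 :: real^'d^'d)" by (simp add: mat_def vec_eq_iff)
  then show ?thesis by (simp flip: scaleR_matrix_vector_assoc)
qed

lemma transpose_diff_real: "transpose (A - B) = transpose A - transpose (B :: real^'n^'m)"
  by (simp add: transpose_def vec_eq_iff)

lemma transpose_add_real: "transpose (A + B) = transpose A + transpose (B :: real^'n^'m)"
  by (simp add: transpose_def vec_eq_iff)

text \<open>
  A zero \<open>x\<close> of a non-negative quadratic form is a minimum of it, so its gradient
  \<open>2 B x\<close> vanishes there.
\<close>

lemma nonneg_injective_pos_def:
  fixes B :: "real^'d^'d"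
  assumes sym: "transpose B = B" and nonneg: "\<And>y. 0 \<le> y \<bullet> (B *v y)"
    and inj: "\<And>y. B *v y = 0 \<Longrightarrow> y = 0"
  shows "pos_def B"
  unfolding pos_def_def
proof (intro conjI allI impI sym)
  fix x :: "real^'d" assume x: "x \<noteq> 0"
  define z where "z = B *v x"
  have z: "z \<bullet> z > 0" using inj[of x] x by (auto simp: z_def)
  have "x \<bullet> (B *v x) \<noteq> 0"
  proof
    assume 0: "x \<bullet> (B *v x) = 0"
    \<comment> \<open>Compare the value at \<open>x\<close> with that at \<open>x - e B x\<close>.\<close>
    have ineq: "2 * (z \<bullet> z) \<le> e * (z \<bullet> (B *v z))" if "e > 0" for e
    proof -
      have "0 \<le> (x - e *\<^sub>R z) \<bullet> (B *v (x - e *\<^sub>R z))" by (rule nonneg)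
      also have "\<dots> = x \<bullet> (B *v x) - 2 * e * (z \<bullet> z) + e\<^sup>2 * (z \<bullet> (B *v z))"
        using symmetric_matrix_inner[OF sym, of x z]
        by (simp add: matrix_vector_mult_diff_distrib matrix_vector_mult_scaleR inner_diff_left
            inner_diff_right power2_eq_square z_def[symmetric] inner_commute algebra_simps)
      finally have "2 * e * (z \<bullet> z) \<le> e\<^sup>2 * (z \<bullet> (B *v z))" using 0 by simp
      then have "e * (2 * (z \<bullet> z)) \<le> e * (e * (z \<bullet> (B *v z)))" by (simp add: power2_eq_square mult_ac)
      then show ?thesis using that by (rule mult_left_le_imp_le)
    qed
    show False
    proof (cases "z \<bullet> (B *v z) > 0")
      case True
      then show False using ineq[of "(z \<bullet> z) / (z \<bullet> (B *v z))"] z by simp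
    next
      case False
      then show False using ineq[of 1] z by linarith
    qed
  qed
  with nonneg[of x] show "0 < x \<bullet> (B *v x)" by linarith
qed

lemma has_derivative_quadratic_form:
  fixes B :: "real^'d^'d"
  assumes "transpose B = B"
  shows "((\<lambda>x. (x - a) \<bullet> (B *v (x - a))) has_derivative (\<lambda>h. (2 *\<^sub>R (B *v (x - a))) \<bullet> h)) (at x)"
proof -
  have d: "((\<lambda>x. B *v (x - a)) has_derivative (\<lambda>h. B *v h)) (at x)"
    by (rule bounded_linear.has_derivative[OF matrix_vector_mul_bounded_linear])
       (auto intro!: derivative_eq_intros)
  have "((\<lambda>x. (x - a) \<bullet> (B *v (x - a))) has_derivative
      (\<lambda>h. (x - a) \<bullet> (B *v h) + h \<bullet> (B *v (x - a)))) (at x)"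
    by (rule has_derivative_inner[OF _ d]) (auto intro!: derivative_eq_intros)
  then show ?thesis
    by (rule has_derivative_eq_rhs)
      (auto simp: symmetric_matrix_inner[OF assms] inner_commute fun_eq_iff)
qed

lemma pos_def_coercive:
  fixes B :: "real^'d^'d"
  assumes "pos_def B"
  obtains k where "k > 0" "\<And>x. k * (norm x)\<^sup>2 \<le> x \<bullet> (B *v x)"
proof -
  have "continuous_on UNIV (\<lambda>x. (x - 0) \<bullet> (B *v (x - 0)))"
    using has_derivative_quadratic_form[OF pos_defD(1)[OF assms], of 0]
    by (meson continuous_at_imp_continuous_on has_derivative_continuous)
  then have "continuous_on (sphere 0 1) (\<lambda>x. x \<bullet> (B *v x))" by (auto intro: continuous_on_subset)
  moreover have "sphere (0::real^'d) 1 \<noteq> {}" by simp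
  ultimately obtain p where p: "p \<in> sphere 0 1" "\<And>x. x \<in> sphere 0 1 \<Longrightarrow> p \<bullet> (B *v p) \<le> x \<bullet> (B *v x)"
    using continuous_attains_inf[of "sphere (0::real^'d) 1" "\<lambda>x. x \<bullet> (B *v x)"] by auto
  have "p \<noteq> 0" using p(1) by auto
  then have "0 < p \<bullet> (B *v p)" using pos_defD(2)[OF assms] by blast
  moreover have "p \<bullet> (B *v p) * (norm x)\<^sup>2 \<le> x \<bullet> (B *v x)" for x
  proof (cases "x = 0")
    case False
    define y where "y = (1 / norm x) *\<^sub>R x"
    have "p \<bullet> (B *v p) \<le> y \<bullet> (B *v y)" using False by (intro p(2)) (simp add: y_def)
    also have "\<dots> = x \<bullet> (B *v x) / (norm x)\<^sup>2"
      by (simp add: y_def matrix_vector_mult_scaleR power2_eq_square)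
    finally show ?thesis using False by (simp add: field_simps)
  qed simp
  ultimately show ?thesis by (rule that)
qed

text \<open>
  Coercivity reduces the search for a minimum to a compact ball.
\<close>

lemma quadratic_form_nearest_point:
  fixes B :: "real^'d^'d"
  assumes B: "pos_def B" and K: "closed K" "K \<noteq> {}"
  shows "\<exists>p\<in>K. \<forall>x\<in>K. (p - a) \<bullet> (B *v (p - a)) \<le> (x - a) \<bullet> (B *v (x - a))"
proof -
  define q where "q x = (x - a) \<bullet> (B *v (x - a))" for x
  obtain k where k: "k > 0" "\<And>x. k * (norm x)\<^sup>2 \<le> x \<bullet> (B *v x)" using pos_def_coercive[OF B] by blast
  obtain z where z: "z \<in> K" using K(2) by blast
  define R where "R = sqrt (q z / k)"
  have qz: "q z \<ge> 0" unfolding q_def by (rule pos_defD(3)[OF B])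
  have big: "q z < q x" if "x \<notin> cball a R" for x
  proof -
    have "R < norm (x - a)" using that by (simp add: dist_norm norm_minus_commute)
    moreover have "0 \<le> R" using qz k by (simp add: R_def)
    ultimately have "R\<^sup>2 < (norm (x - a))\<^sup>2" by (intro power_strict_mono) auto
    then have "q z < k * (norm (x - a))\<^sup>2" using k(1) qz by (simp add: R_def field_simps)
    also have "\<dots> \<le> q x" unfolding q_def by (rule k(2))
    finally show ?thesis .
  qed
  have "continuous_on (K \<inter> cball a R) q"
    using has_derivative_quadratic_form[OF pos_defD(1)[OF B], of a] unfolding q_def
    by (meson continuous_at_imp_continuous_on has_derivative_continuous)
  moreover have "compact (K \<inter> cball a R)" using K(1) by (intro closed_Int_compact) auto
  moreover have "z \<in> K \<inter> cball a R" using z big[of z] by auto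
  ultimately obtain p where p: "p \<in> K \<inter> cball a R" "\<And>x. x \<in> K \<inter> cball a R \<Longrightarrow> q p \<le> q x"
    using continuous_attains_inf[of "K \<inter> cball a R" q] by blast
  have "q p \<le> q x" if "x \<in> K" for x
  proof (cases "x \<in> cball a R")
    case False
    have "q p \<le> q z" using p(2) \<open>z \<in> K \<inter> cball a R\<close> by blast
    then show ?thesis using big[OF False] by simp
  qed (use p(2) that in blast)
  with p(1) show ?thesis unfolding q_def by blast
qed

text \<open>
  A direction in which the form is not positive would give a whole ray of points in the set.
\<close>

lemma bounded_ellipsoid_pos_def:
  fixes B :: "real^'d^'d"
  assumes "transpose B = B" "bounded {x. (x - c) \<bullet> (B *v (x - c)) < r\<^sup>2}" "0 < r"
  shows "pos_def B"
  unfolding pos_def_def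
proof (intro conjI allI impI assms(1))
  fix y :: "real^'d" assume y: "y \<noteq> 0"
  show "0 < y \<bullet> (B *v y)"
  proof (rule ccontr)
    assume neg: "\<not> 0 < y \<bullet> (B *v y)"
    obtain M where M: "M > 0" "\<And>x. (x - c) \<bullet> (B *v (x - c)) < r\<^sup>2 \<Longrightarrow> norm x \<le> M"
      using assms(2) unfolding bounded_pos by auto
    define t where "t = (M + norm c + 1) / norm y"
    define x where "x = c + t *\<^sub>R y"
    have "(x - c) \<bullet> (B *v (x - c)) = t\<^sup>2 * (y \<bullet> (B *v y))"
      by (simp add: x_def matrix_vector_mult_scaleR power2_eq_square)
    also have "\<dots> \<le> 0" using neg by (intro mult_nonneg_nonpos) auto
    also have "0 < r\<^sup>2" using assms(3) by simp
    finally have "norm x \<le> M" by (rule M(2))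
    moreover have "norm (t *\<^sub>R y) = M + norm c + 1" using y M(1) by (simp add: t_def)
    moreover have "norm (t *\<^sub>R y) \<le> norm x + norm c"
      using norm_triangle_ineq4[of x c] by (simp add: x_def)
    ultimately show False by linarith
  qed
qed

section \<open>Domains with an affine normal field\<close>

text \<open>
  The field \<open>B x - b\<close> is the gradient of a quadratic function \<open>\<psi>\<close>. At a minimum over the
  closure lying on the frontier, \<open>- grad \<psi>\<close> is a non-negative multiple of the normal; so is
  \<open>grad \<psi>\<close> up to scaling, which would force the normal to vanish. Hence the minimum is interior.
\<close>

lemma affine_normal_field_centre:
  fixes B :: "real^'d^'d"
  assumes \<Omega>: "open \<Omega>" "bounded \<Omega>" "\<Omega> \<noteq> {}" "C1_boundary \<Omega>"
    and sym: "transpose B = B"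
    and normal: "\<And>x. x \<in> frontier \<Omega> \<Longrightarrow> \<exists>t\<ge>0. outward_normal \<Omega> x = t *\<^sub>R (B *v x - b)"
  obtains c where "c \<in> \<Omega>" "B *v c = b" "\<And>y. 0 \<le> y \<bullet> (B *v y)"
proof -
  define \<psi> where "\<psi> x = (x \<bullet> (B *v x)) / 2 - b \<bullet> x" for x
  have der: "(\<psi> has_derivative (\<lambda>h. (B *v x - b) \<bullet> h)) (at x)" for x
  proof -
    have "((\<lambda>x. (x \<bullet> (B *v x)) / 2) has_derivative (\<lambda>h. (2 *\<^sub>R (B *v x)) \<bullet> h / 2)) (at x)"
      using has_derivative_mult_right[OF has_derivative_quadratic_form[OF sym, of 0 x], of "1 / 2"] by simp
    then have "((\<lambda>x. (x \<bullet> (B *v x)) / 2) has_derivative (\<lambda>h. (B *v x) \<bullet> h)) (at x)" by simp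
    from has_derivative_diff[OF this has_derivative_inner_right[OF has_derivative_ident, of b]]
    show ?thesis unfolding \<psi>_def by (simp add: inner_diff_left)
  qed
  have "continuous_on (closure \<Omega>) \<psi>"
    using der by (meson continuous_at_imp_continuous_on has_derivative_continuous)
  moreover have "compact (closure \<Omega>)" "closure \<Omega> \<noteq> {}" using \<Omega> by auto
  ultimately obtain p where p: "p \<in> closure \<Omega>" "\<And>x. x \<in> closure \<Omega> \<Longrightarrow> \<psi> p \<le> \<psi> x"
    using continuous_attains_inf by metis
  have min: "\<psi> p \<le> \<psi> x" if "x \<in> \<Omega>" for x using p(2) that closure_subset by blast
  have "p \<notin> frontier \<Omega>"
  proof
    assume fr: "p \<in> frontier \<Omega>"
    then obtain U \<rho> where \<rho>: "C1_defining_function \<Omega> p U \<rho>" using \<Omega>(4) by (auto simp: C1_boundary_def)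
    note R = C1_defining_functionD[OF \<rho>]
    obtain k where k: "k \<ge> 0" "- (B *v p - b) = k *\<^sub>R grad \<rho> p"
      using frontier_minimum_from_inside[OF \<rho> \<Omega>(1) fr der min] by blast
    obtain t where t: "t \<ge> 0" "outward_normal \<Omega> p = t *\<^sub>R (B *v p - b)" using normal[OF fr] by blast
    have "grad \<rho> p = norm (grad \<rho> p) *\<^sub>R outward_normal \<Omega> p"
      using outward_normal_eq[OF \<rho> \<Omega>(1) fr] R(4)[OF R(2)] by simp
    also have "\<dots> = - ((norm (grad \<rho> p) * t * k) *\<^sub>R grad \<rho> p)"
    proof -
      have "B *v p - b = - (k *\<^sub>R grad \<rho> p)" using k(2) by (metis minus_minus)
      then show ?thesis unfolding t(2) by simp
    qed
    finally have "(1 + norm (grad \<rho> p) * t * k) *\<^sub>R grad \<rho> p = 0"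
      by (simp add: scaleR_add_left flip: eq_neg_iff_add_eq_0)
    moreover have "1 + norm (grad \<rho> p) * t * k > 0" using t k by (intro add_pos_nonneg) auto
    ultimately show False using R(4)[OF R(2)] by simp
  qed
  with p(1) have p\<Omega>: "p \<in> \<Omega>" by (simp add: closure_Un_frontier)
  have crit: "B *v p - b = 0" by (rule interior_minimum[OF \<Omega>(1) p\<Omega> der min])
  have "0 \<le> y \<bullet> (B *v y)" for y
  proof -
    have "\<forall>\<^sub>F s in at_right 0. (0::real) < s \<and> p + s *\<^sub>R y \<in> \<Omega>"
      by (intro eventually_conj eventually_in_open_right \<Omega> p\<Omega>) (simp add: eventually_at_right_less)
    then obtain s :: real where s: "s > 0" "p + s *\<^sub>R y \<in> \<Omega>"
      using eventually_happens'[OF trivial_limit_at_right_real] by blast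
    have "\<psi> (p + s *\<^sub>R y) - \<psi> p = s * ((B *v p - b) \<bullet> y) + s\<^sup>2 / 2 * (y \<bullet> (B *v y))"
    proof -
      have "p \<bullet> (B *v y) = (B *v p) \<bullet> y" "y \<bullet> (B *v p) = (B *v p) \<bullet> y"
        using symmetric_matrix_inner[OF sym] by (auto simp: inner_commute)
      then show ?thesis
        unfolding \<psi>_def
        by (simp add: matrix_vector_right_distrib matrix_vector_mult_scaleR inner_add_left inner_add_right
            inner_diff_left power2_eq_square field_simps)
    qed
    with crit min[OF s(2)] have "s\<^sup>2 / 2 * (y \<bullet> (B *v y)) \<ge> 0" by simp
    with s(1) show ?thesis by (simp add: zero_le_mult_iff)
  qed
  with p\<Omega> crit that show ?thesis by simp
qed

text \<open>
  Among the points outside \<open>\<Omega>\<close> one minimises the distance, in the norm of \<open>B\<close>, to a centre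
  \<open>c + \<epsilon> w\<close>. At the minimiser \<open>p\<close> the gradient \<open>2 B (p - c - \<epsilon> w)\<close> is parallel
  to the normal and therefore to \<open>B (p - c)\<close>, which puts \<open>p\<close> on the line through \<open>c\<close> in
  direction \<open>w\<close>. Comparison with one known nearest point \<open>x\<close> to \<open>c\<close> shows that \<open>p\<close> is on the
  side of \<open>w\<close> and close to \<open>c + w\<close>.

  The comparison fails only if \<open>x\<close> is opposite to \<open>c + w\<close>. This one direction is reached by
  starting from a different nearest point, which exists in dimension at least two.
\<close>

lemma radial_normal_field_ellipsoid:
  fixes B :: "real^'d^'d" and \<Omega> :: "(real^'d) set"
  assumes dim: "CARD('d) \<ge> 2"
    and \<Omega>: "open \<Omega>" "connected \<Omega>" "bounded \<Omega>" "C1_boundary \<Omega>"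
    and B: "pos_def B" and c: "c \<in> \<Omega>"
    and normal: "\<And>x. x \<in> frontier \<Omega> \<Longrightarrow> \<exists>t\<ge>0. outward_normal \<Omega> x = t *\<^sub>R (B *v (x - c))"
  shows "\<exists>r>0. \<Omega> = {x. (x - c) \<bullet> (B *v (x - c)) < r\<^sup>2}"
proof -
  define Q where "Q y = y \<bullet> (B *v y)" for y
  have sym: "transpose B = B" by (rule pos_defD(1)[OF B])
  have Qpos: "y \<noteq> 0 \<Longrightarrow> Q y > 0" and Qle: "Q y \<le> 0 \<Longrightarrow> y = 0" for y
    unfolding Q_def using pos_defD[OF B] by auto
  have Q_scale: "Q (t *\<^sub>R y) = t\<^sup>2 * Q y" for t y
    by (simp add: Q_def matrix_vector_mult_scaleR power2_eq_square)
  have Q_add: "Q (x + y) = Q x + 2 * (x \<bullet> (B *v y)) + Q y" for x y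
    using symmetric_matrix_inner[OF sym, of y x]
    by (simp add: Q_def matrix_vector_right_distrib inner_add_left inner_add_right inner_commute)
  have K: "closed (- \<Omega>)" "- \<Omega> \<noteq> {}"
    using \<Omega>(1,3) not_bounded_UNIV[where 'a = "real^'d"] by (metis boolean_algebra.compl_zero double_complement open_closed)+
  obtain z where z: "z \<in> - \<Omega>" "\<And>x. x \<in> - \<Omega> \<Longrightarrow> Q (z - c) \<le> Q (x - c)"
    using quadratic_form_nearest_point[OF B K, of c] unfolding Q_def by blast
  define m where "m = Q (z - c)"
  have m: "m > 0" using z(1) c Qpos[of "z - c"] by (auto simp: m_def)
  have spread: "c + w \<notin> \<Omega>" if w: "Q w = m" and x: "x \<notin> \<Omega>" "Q (x - c) = m" "w \<noteq> - (x - c)" for w x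
  proof
    assume "c + w \<in> \<Omega>"
    then obtain e where e: "e > 0" "ball (c + w) e \<subseteq> \<Omega>" using \<Omega>(1) open_contains_ball by blast
    obtain e' where e': "e' > 0" "ball c e' \<subseteq> \<Omega>" using \<Omega>(1) c open_contains_ball by blast
    \<comment> \<open>Small enough for \<open>c + \<epsilon> w\<close> to lie in \<open>\<Omega>\<close>, and for points within \<open>2 \<epsilon> |w|\<close> of \<open>c + w\<close> to do so.\<close>
    define \<epsilon> where "\<epsilon> = min e e' / (3 * (norm w + 1))"
    have n1: "3 * (norm w + 1) > 0" by (intro mult_pos_pos add_nonneg_pos) auto
    have \<epsilon>: "\<epsilon> > 0" using e e' n1 by (simp add: \<epsilon>_def)
    have "\<epsilon> * (3 * (norm w + 1)) = min e e'" unfolding \<epsilon>_def using n1 by simp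
    then have "3 * (\<epsilon> * norm w) + 3 * \<epsilon> = min e e'" by (simp add: algebra_simps)
    moreover have "0 \<le> \<epsilon> * norm w" using \<epsilon> by simp
    moreover have "min e e' \<le> e" "min e e' \<le> e'" by simp_all
    ultimately have \<epsilon>2: "2 * (\<epsilon> * norm w) < e" "\<epsilon> * norm w < e'"
      using \<epsilon> by linarith+
    define a where "a = c + \<epsilon> *\<^sub>R w"
    have a\<Omega>: "a \<in> \<Omega>" using e'(2) \<epsilon>2(2) \<epsilon> by (auto simp: a_def subset_iff dist_norm)
    have w0: "w \<noteq> 0" using w m by (auto simp: Q_def)
    \<comment> \<open>The strict Cauchy-Schwarz inequality for two vectors of equal length that are not opposite.\<close>
    have inner_gt: "(x - c) \<bullet> (B *v w) > - m"
    proof (rule ccontr)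
      assume "\<not> ?thesis"
      then have "Q (x - c + w) \<le> 0" using Q_add[of "x - c" w] w x(2) by linarith
      then show False using Qle x(3) by (metis add_eq_0_iff add.commute)
    qed
    obtain p where p: "p \<in> - \<Omega>" "\<And>x. x \<in> - \<Omega> \<Longrightarrow> Q (p - a) \<le> Q (x - a)"
      using quadratic_form_nearest_point[OF B K, of a] unfolding Q_def by blast
    have der: "((\<lambda>x. Q (x - a)) has_derivative (\<lambda>h. (2 *\<^sub>R (B *v (p - a))) \<bullet> h)) (at p)"
      unfolding Q_def by (rule has_derivative_quadratic_form[OF sym])
    have fr: "p \<in> frontier \<Omega>"
    proof (rule ccontr)
      assume "p \<notin> frontier \<Omega>"
      then have p': "p \<in> - closure \<Omega>" using p(1) by (simp add: closure_Un_frontier)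
      have "2 *\<^sub>R (B *v (p - a)) = 0"
        by (rule interior_minimum[OF _ p' der]) (use p(2) closure_subset[of \<Omega>] in auto)
      then have "B *v p = B *v a" by (simp add: matrix_vector_mult_diff_distrib)
      then have "p = a" by (rule pos_def_inj[OF B])
      then show False using a\<Omega> p(1) by simp
    qed
    obtain U \<rho> where \<rho>: "C1_defining_function \<Omega> p U \<rho>" using \<Omega>(4) fr by (auto simp: C1_boundary_def)
    note R = C1_defining_functionD[OF \<rho>]
    obtain k where k: "2 *\<^sub>R (B *v (p - a)) = k *\<^sub>R grad \<rho> p"
      using frontier_minimum_from_outside[OF \<rho> \<Omega>(1) fr der] p(2) by auto
    obtain t where t: "outward_normal \<Omega> p = t *\<^sub>R (B *v (p - c))" using normal[OF fr] by blast
    define s where "s = k * norm (grad \<rho> p) * t / 2"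
    have "grad \<rho> p = norm (grad \<rho> p) *\<^sub>R outward_normal \<Omega> p"
      using outward_normal_eq[OF \<rho> \<Omega>(1) fr] R(4)[OF R(2)] by simp
    then have "grad \<rho> p = (norm (grad \<rho> p) * t) *\<^sub>R (B *v (p - c))" unfolding t by simp
    with k have "2 *\<^sub>R (B *v (p - a)) = k *\<^sub>R ((norm (grad \<rho> p) * t) *\<^sub>R (B *v (p - c)))" by metis
    then have "B *v (p - a) = s *\<^sub>R (B *v (p - c))"
      by (simp add: s_def vec_eq_iff field_simps)
    then have "B *v (p - a) = B *v (s *\<^sub>R (p - c))" by (simp add: matrix_vector_mult_scaleR)
    then have "p - a = s *\<^sub>R (p - c)" by (rule pos_def_inj[OF B])
    then have s: "(1 - s) *\<^sub>R (p - c) = \<epsilon> *\<^sub>R w" by (simp add: a_def algebra_simps)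
    have "s \<noteq> 1" using s \<epsilon> w0 by auto
    define \<tau> where "\<tau> = \<epsilon> / (1 - s)"
    have \<tau>: "p - c = \<tau> *\<^sub>R w"
    proof -
      have "p - c = (1 / (1 - s)) *\<^sub>R ((1 - s) *\<^sub>R (p - c))" using \<open>s \<noteq> 1\<close> by simp
      then show ?thesis unfolding s \<tau>_def by simp
    qed
    have "m \<le> \<tau>\<^sup>2 * m" using z(2)[OF p(1)] unfolding \<tau> Q_scale w m_def[symmetric] .
    \<comment> \<open>\<open>p\<close> is no nearer to \<open>c\<close> than the nearest points are.\<close>
    then have \<tau>1: "1 \<le> \<bar>\<tau>\<bar>" using m by (simp add: abs_le_square_iff[of 1 \<tau>, simplified])
    have "Q (p - a) = (\<tau> - \<epsilon>)\<^sup>2 * m"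
    proof -
      have "p - a = (\<tau> - \<epsilon>) *\<^sub>R w" using \<tau> by (simp add: a_def algebra_simps)
      then show ?thesis by (simp add: Q_scale w)
    qed
    moreover have "Q (x - a) = m - 2 * \<epsilon> * ((x - c) \<bullet> (B *v w)) + \<epsilon>\<^sup>2 * m"
    proof -
      have "Q (x - a) = Q ((x - c) + (- \<epsilon>) *\<^sub>R w)" by (simp add: a_def algebra_simps)
      also have "\<dots> = Q (x - c) + 2 * ((x - c) \<bullet> (B *v ((- \<epsilon>) *\<^sub>R w))) + (- \<epsilon>)\<^sup>2 * Q w"
        by (simp only: Q_add Q_scale)
      also have "(x - c) \<bullet> (B *v ((- \<epsilon>) *\<^sub>R w)) = - \<epsilon> * ((x - c) \<bullet> (B *v w))"
        by (simp only: matrix_vector_mult_scaleR inner_scaleR_right)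
      finally show ?thesis by (simp add: w x(2))
    qed
    ultimately have le: "(\<tau> - \<epsilon>)\<^sup>2 * m \<le> m - 2 * \<epsilon> * ((x - c) \<bullet> (B *v w)) + \<epsilon>\<^sup>2 * m"
      using p(2)[of x] x(1) by simp
    also have "\<dots> < m + 2 * \<epsilon> * m + \<epsilon>\<^sup>2 * m"
      using mult_strict_left_mono[OF inner_gt, of "2 * \<epsilon>"] \<epsilon> by simp
    also have "\<dots> = (1 + \<epsilon>)\<^sup>2 * m" by (simp add: power2_eq_square algebra_simps)
    finally have "(\<tau> - \<epsilon>)\<^sup>2 < (1 + \<epsilon>)\<^sup>2" using m by simp
    then have "\<bar>\<tau> - \<epsilon>\<bar> < 1 + \<epsilon>" using \<epsilon> by (metis abs_of_pos add_pos_pos power2_less_imp_less power2_abs zero_less_one less_imp_le)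
    with \<tau>1 \<epsilon> have "1 \<le> \<tau>" "\<tau> - 1 \<le> 2 * \<epsilon>" by linarith+
    then have "dist (c + w) p \<le> 2 * \<epsilon> * norm w"
    proof -
      have "p - (c + w) = (\<tau> - 1) *\<^sub>R w" using \<tau> by (simp add: algebra_simps)
      then have "dist p (c + w) = (\<tau> - 1) * norm w" using \<open>1 \<le> \<tau>\<close> by (simp add: dist_norm)
      then show ?thesis using \<open>\<tau> - 1 \<le> 2 * \<epsilon>\<close> by (simp add: dist_commute mult_right_mono)
    qed
    then have "p \<in> \<Omega>" using \<epsilon>2(1) e(2) by (auto simp: subset_iff)
    then show False using p(1) by simp
  qed
  have sphere: "c + w \<notin> \<Omega>" if w: "Q w = m" for w
  proof (cases "w = - (z - c)")
    case False
    then show ?thesis using spread[OF w, of z] z(1) by (simp add: m_def)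
  next
    case True
    have "\<exists>v. v \<notin> span {z - c}"
    proof (rule ccontr)
      assume "\<not> ?thesis"
      then have "span {z - c} = UNIV" by blast
      then have "DIM(real^'d) \<le> card {z - c}" by (metis dim_UNIV dim_le_card finite.emptyI finite_insert top_greatest)
      then show False using dim by simp
    qed
    then obtain v where v: "v \<notin> span {z - c}" by blast
    then have "v \<noteq> 0" using span_zero by auto
    define w' where "w' = sqrt (m / Q v) *\<^sub>R v"
    have Qv: "Q v > 0" using Qpos \<open>v \<noteq> 0\<close> by blast
    have Qw': "Q w' = m" using m Qv by (simp add: w'_def Q_scale)
    have ns: "w' \<noteq> t *\<^sub>R (z - c)" for t
    proof
      assume "w' = t *\<^sub>R (z - c)"
      then have "sqrt (m / Q v) *\<^sub>R v \<in> span {z - c}" by (simp add: w'_def span_mul span_base)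
      then have "(1 / sqrt (m / Q v)) *\<^sub>R sqrt (m / Q v) *\<^sub>R v \<in> span {z - c}" by (rule span_mul)
      then show False using v m Qv by simp
    qed
    have "c + w' \<notin> \<Omega>" using spread[OF Qw', of z] z(1) ns[of "-1"] by (simp add: m_def)
    moreover have "w \<noteq> - (c + w' - c)"
      using ns[of 1] True by (metis add_diff_cancel_left' neg_equal_iff_equal scaleR_one)
    ultimately show ?thesis using spread[OF w, of "c + w'"] Qw' by simp
  qed
  have cont: "continuous_on UNIV (\<lambda>x. Q (x - c))"
    using has_derivative_quadratic_form[OF sym, of c] unfolding Q_def
    by (meson continuous_at_imp_continuous_on has_derivative_continuous)
  have "{x. Q (x - c) < m} \<subseteq> \<Omega>" using z(2) by (force simp: m_def)
  moreover have "\<Omega> \<subseteq> {x. Q (x - c) < m}"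
  proof (rule ccontr)
    assume "\<not> ?thesis"
    moreover have "Q (x - c) \<noteq> m" if "x \<in> \<Omega>" for x using sphere[of "x - c"] that by auto
    ultimately have "\<exists>x\<in>\<Omega>. Q (x - c) > m" by (force simp: not_less le_less)
    moreover have "open {x. Q (x - c) < m}" "open {x. m < Q (x - c)}"
      by (intro open_Collect_less cont continuous_intros)+
    moreover have "\<Omega> \<subseteq> {x. Q (x - c) < m} \<union> {x. m < Q (x - c)}"
      using \<open>\<And>x. x \<in> \<Omega> \<Longrightarrow> Q (x - c) \<noteq> m\<close> by force
    moreover have "c \<in> {x. Q (x - c) < m}" using m by (simp add: Q_def)
    moreover have "{x. Q (x - c) < m} \<inter> {x. m < Q (x - c)} \<inter> \<Omega> = {}" by auto
    ultimately show False using connectedD[OF \<Omega>(2)] c by blast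
  qed
  ultimately have "\<Omega> = {x. Q (x - c) < (sqrt m)\<^sup>2}" using m by auto
  then show ?thesis using m unfolding Q_def by (intro exI[of _ "sqrt m"]) auto
qed

section \<open>Neutral inclusions are ellipsoids\<close>

lemma conductivity_cases:
  assumes "open \<Omega>"
  shows "x \<in> \<Omega> \<Longrightarrow> conductivity \<Omega> \<sigma>c \<sigma>m x = mat \<sigma>c"
    "x \<in> - closure \<Omega> \<Longrightarrow> conductivity \<Omega> \<sigma>c \<sigma>m x = \<sigma>m"
  using closure_subset[of \<Omega>] by (auto simp: conductivity_def indicator_def)

lemma affine_grad:
  fixes u :: "real^'d \<Rightarrow> real"
  assumes "open S" and u: "\<And>y. y \<in> S \<Longrightarrow> u y = s \<bullet> y + k" and x: "x \<in> S"
  shows "u differentiable (at x)" "grad u x = s" "(grad u has_derivative (\<lambda>_. 0)) (at x)"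
proof -
  have d: "(u has_derivative (\<lambda>h. s \<bullet> h)) (at y)" if y: "y \<in> S" for y
  proof -
    have "((\<lambda>y. s \<bullet> y + k) has_derivative (\<lambda>h. s \<bullet> h)) (at y)" by (auto intro!: derivative_eq_intros)
    then show ?thesis by (rule has_derivative_transform_within_open[OF _ \<open>open S\<close> y]) (simp add: u)
  qed
  show "u differentiable (at x)" using d[OF x] by (auto simp: differentiable_def)
  have g: "grad u y = s" if "y \<in> S" for y using d[OF that] by (rule grad_unique)
  then show "grad u x = s" using x .
  show "(grad u has_derivative (\<lambda>_. 0)) (at x)"
    by (rule has_derivative_transform_within_open[OF has_derivative_const[of s] \<open>open S\<close> x]) (simp add: g)
qed

text \<open>
  The conductivity is the constant multiple \<open>\<sigma>c\<close> of the identity near a point of the open set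
  \<open>\<Omega>\<close>, so the equation reduces to Laplace's equation.
\<close>

lemma solution_harmonic_inside:
  fixes u :: "real^'d \<Rightarrow> real"
  assumes sol: "imperfect_interface_solution \<Omega> \<sigma>c \<sigma>m \<beta> a u" and \<Omega>: "open \<Omega>" and "0 < \<sigma>c" and x: "x \<in> \<Omega>"
  shows "trace (jacobian (grad u) (at x)) = 0"
proof -
  define H where "H = frechet_derivative (grad u) (at x)"
  have "grad u differentiable (at x)"
    using sol x by (auto simp: imperfect_interface_solution_def C2_on_def)
  then have H: "(grad u has_derivative H) (at x)" unfolding H_def by (simp add: frechet_derivative_works)
  have "((\<lambda>y. \<sigma>c *\<^sub>R grad u y) has_derivative (\<lambda>h. \<sigma>c *\<^sub>R H h)) (at x)"
    by (rule has_derivative_scaleR_right[OF H])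
  then have "((\<lambda>y. conductivity \<Omega> \<sigma>c \<sigma>m y *v grad u y) has_derivative (\<lambda>h. \<sigma>c *\<^sub>R H h)) (at x)"
    by (rule has_derivative_transform_within_open[OF _ \<Omega> x])
       (simp add: conductivity_cases[OF \<Omega>] matrix_vector_mult_mat)
  then have "frechet_derivative (\<lambda>y. conductivity \<Omega> \<sigma>c \<sigma>m y *v grad u y) (at x) = (\<lambda>h. \<sigma>c *\<^sub>R H h)"
    by (metis frechet_derivative_at)
  then have "divergence (\<lambda>y. conductivity \<Omega> \<sigma>c \<sigma>m y *v grad u y) x = \<sigma>c * trace (matrix H)"
    by (simp add: divergence_def jacobian_def trace_def matrix_def sum_distrib_left)
  moreover have "divergence (\<lambda>y. conductivity \<Omega> \<sigma>c \<sigma>m y *v grad u y) x = 0"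
    using sol x by (auto simp: imperfect_interface_solution_def)
  ultimately show ?thesis using \<open>0 < \<sigma>c\<close> by (simp add: jacobian_def H_def)
qed

text \<open>
  Subtracting the linear function with gradient \<open>s = (\<sigma>m *v a) / \<sigma>c\<close> from the inner solution
  leaves a harmonic function with zero flux, which is a constant \<open>k\<close>. The interface condition then
  relates \<open>\<beta>\<close>, the normal and the position.
\<close>

lemma neutral_boundary_relation:
  fixes \<Omega> :: "(real^'d) set"
  assumes \<Omega>: "open \<Omega>" "connected \<Omega>" "bounded \<Omega>" "C1_boundary \<Omega>" and \<sigma>c: "0 < \<sigma>c"
    and neutral: "neutral_to \<Omega> \<sigma>c \<sigma>m \<beta> a"
  shows "\<exists>k. \<forall>x\<in>frontier \<Omega>.
    \<beta> x * (a \<bullet> x - (\<sigma>m *v a) \<bullet> x / \<sigma>c - k) = outward_normal \<Omega> x \<bullet> (\<sigma>m *v a)"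
proof -
  obtain u where sol: "imperfect_interface_solution \<Omega> \<sigma>c \<sigma>m \<beta> a u"
    and out: "\<And>x. x \<in> - \<Omega> \<Longrightarrow> u x = a \<bullet> x"
    using neutral by (force simp: neutral_to_def)
  define s where "s = (1 / \<sigma>c) *\<^sub>R (\<sigma>m *v a)"
  have C2: "u differentiable (at x)" "grad u differentiable (at x)" if "x \<in> \<Omega>" for x
    using sol that by (auto simp: imperfect_interface_solution_def C2_on_def)
  have cJ: "continuous_on \<Omega> (\<lambda>x. jacobian (grad u) (at x))"
    using sol by (auto simp: imperfect_interface_solution_def C2_on_def intro: continuous_on_subset)
  define H where "H x = frechet_derivative (grad u) (at x)" for x
  have dG: "(grad u has_derivative H x) (at x)" if "x \<in> \<Omega>" for x
    using C2(2)[OF that] unfolding H_def by (simp add: frechet_derivative_works)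
  \<comment> \<open>Outside, \<open>u\<close> is the uniform field, so its limits are \<open>a \<bullet> x\<close> and \<open>a\<close>.\<close>
  have interface: "((\<lambda>x. u x - s \<bullet> x) \<longlongrightarrow> um - s \<bullet> x) (at x within \<Omega>) \<and>
      ((\<lambda>x. grad u x - s) \<longlongrightarrow> gm - s) (at x within \<Omega>) \<and>
      outward_normal \<Omega> x \<bullet> (gm - s) = 0 \<and>
      \<beta> x * (a \<bullet> x - um) = outward_normal \<Omega> x \<bullet> (\<sigma>m *v a)"
    if x: "x \<in> frontier \<Omega>" and lims: "(u \<longlongrightarrow> up) (at x within - closure \<Omega>)" "(u \<longlongrightarrow> um) (at x within \<Omega>)"
      "(grad u \<longlongrightarrow> gp) (at x within - closure \<Omega>)" "(grad u \<longlongrightarrow> gm) (at x within \<Omega>)"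
      "\<beta> x * (up - um) = outward_normal \<Omega> x \<bullet> (\<sigma>m *v gp)"
      "\<sigma>c * (outward_normal \<Omega> x \<bullet> gm) = outward_normal \<Omega> x \<bullet> (\<sigma>m *v gp)" for x up um gp gm
  proof -
    obtain U \<rho> where \<rho>: "C1_defining_function \<Omega> x U \<rho>" using \<Omega>(4) x by (auto simp: C1_boundary_def)
    note nontrivial = frontier_limit_points[OF \<rho> \<Omega>(1) x]
    have ev: "\<forall>\<^sub>F y in at x within - closure \<Omega>. y \<in> - closure \<Omega>"
      by (simp add: eventually_at_filter)
    have u_out: "u y = a \<bullet> y + 0" if "y \<in> - closure \<Omega>" for y
      using out[of y] that closure_subset by force
    have "\<forall>\<^sub>F y in at x within - closure \<Omega>. a = grad u y"
      using ev by eventually_elim (metis affine_grad(2)[OF _ u_out] open_Compl closed_closure)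
    then have "(grad u \<longlongrightarrow> a) (at x within - closure \<Omega>)" by (rule Lim_transform_eventually[OF tendsto_const])
    with lims(3) have gp: "gp = a" using nontrivial(2) tendsto_unique by blast
    have "((\<lambda>y. a \<bullet> y) \<longlongrightarrow> a \<bullet> x) (at x within - closure \<Omega>)" by (intro tendsto_intros)
    moreover have "\<forall>\<^sub>F y in at x within - closure \<Omega>. a \<bullet> y = u y"
      using ev by eventually_elim (simp add: u_out)
    ultimately have "(u \<longlongrightarrow> a \<bullet> x) (at x within - closure \<Omega>)" by (rule Lim_transform_eventually)
    with lims(1) have up: "up = a \<bullet> x" using nontrivial(2) tendsto_unique by blast
    have "outward_normal \<Omega> x \<bullet> (gm - s) = 0"
      using lims(6) \<sigma>c unfolding gp by (simp add: s_def inner_diff_right field_simps)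
    moreover have "((\<lambda>x. u x - s \<bullet> x) \<longlongrightarrow> um - s \<bullet> x) (at x within \<Omega>)"
      by (intro tendsto_intros lims)
    moreover have "((\<lambda>x. grad u x - s) \<longlongrightarrow> gm - s) (at x within \<Omega>)"
      by (intro tendsto_intros lims)
    ultimately show ?thesis using lims(5) unfolding gp up by simp
  qed
  have limits: "\<exists>um gm. ((\<lambda>x. u x - s \<bullet> x) \<longlongrightarrow> um - s \<bullet> x) (at x within \<Omega>) \<and>
      ((\<lambda>x. grad u x - s) \<longlongrightarrow> gm - s) (at x within \<Omega>) \<and>
      outward_normal \<Omega> x \<bullet> (gm - s) = 0 \<and>
      \<beta> x * (a \<bullet> x - um) = outward_normal \<Omega> x \<bullet> (\<sigma>m *v a)" if x: "x \<in> frontier \<Omega>" for x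
  proof -
    have "\<exists>up um gp gm. (u \<longlongrightarrow> up) (at x within - closure \<Omega>) \<and> (u \<longlongrightarrow> um) (at x within \<Omega>) \<and>
        (grad u \<longlongrightarrow> gp) (at x within - closure \<Omega>) \<and> (grad u \<longlongrightarrow> gm) (at x within \<Omega>) \<and>
        \<beta> x * (up - um) = outward_normal \<Omega> x \<bullet> (\<sigma>m *v gp) \<and>
        \<sigma>c * (outward_normal \<Omega> x \<bullet> gm) = outward_normal \<Omega> x \<bullet> (\<sigma>m *v gp)"
      using sol x unfolding imperfect_interface_solution_def by blast
    then show ?thesis using interface[OF x] by blast
  qed
  have "\<exists>k. \<forall>x\<in>\<Omega>. u x - s \<bullet> x = k"
  proof (rule neumann_constant[OF \<Omega>, where G = "\<lambda>x. grad u x - s" and H = H])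
    fix x assume x: "x \<in> \<Omega>"
    have "((\<lambda>x. u x - s \<bullet> x) has_derivative (\<lambda>h. grad u x \<bullet> h - s \<bullet> h)) (at x)"
      by (intro has_derivative_diff has_derivative_grad C2(1)[OF x] has_derivative_inner_right has_derivative_ident)
    then show "((\<lambda>x. u x - s \<bullet> x) has_derivative (\<lambda>h. (grad u x - s) \<bullet> h)) (at x)"
      by (simp add: inner_diff_left)
    show "((\<lambda>x. grad u x - s) has_derivative H x) (at x)"
      using has_derivative_diff[OF dG[OF x] has_derivative_const[of s]] by simp
    show "trace (matrix (H x)) = 0"
      using solution_harmonic_inside[OF sol \<Omega>(1) \<sigma>c x] by (simp add: jacobian_def H_def)
  next
    fix v
    have "bounded_linear (\<lambda>M :: real^'d^'d. M *v v)"
      unfolding linear_conv_bounded_linear[symmetric]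
      by (intro linearI) (auto simp: matrix_vector_mult_add_rdistrib scaleR_matrix_vector_assoc)
    from bounded_linear.continuous_on[OF this cJ]
    show "continuous_on \<Omega> (\<lambda>x. H x v)"
    proof (rule continuous_on_eq)
      fix x assume "x \<in> \<Omega>"
      then show "jacobian (grad u) (at x) *v v = H x v"
        using matrix_vector_mul(2)[OF has_derivative_linear[OF dG]]
        by (simp add: jacobian_def H_def fun_eq_iff)
    qed
  next
    fix x assume x: "x \<in> frontier \<Omega>"
    show "\<exists>l. ((\<lambda>x. u x - s \<bullet> x) \<longlongrightarrow> l) (at x within \<Omega>)" using limits[OF x] by blast
    show "\<exists>g. ((\<lambda>x. grad u x - s) \<longlongrightarrow> g) (at x within \<Omega>) \<and> outward_normal \<Omega> x \<bullet> g = 0"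
      using limits[OF x] by blast
  qed
  then obtain k where k: "\<And>x. x \<in> \<Omega> \<Longrightarrow> u x - s \<bullet> x = k" by blast
  have "\<beta> x * (a \<bullet> x - (\<sigma>m *v a) \<bullet> x / \<sigma>c - k) = outward_normal \<Omega> x \<bullet> (\<sigma>m *v a)"
    if x: "x \<in> frontier \<Omega>" for x
  proof -
    obtain um where um: "((\<lambda>x. u x - s \<bullet> x) \<longlongrightarrow> um - s \<bullet> x) (at x within \<Omega>)"
      "\<beta> x * (a \<bullet> x - um) = outward_normal \<Omega> x \<bullet> (\<sigma>m *v a)" using limits[OF x] by blast
    obtain U \<rho> where \<rho>: "C1_defining_function \<Omega> x U \<rho>" using \<Omega>(4) x by (auto simp: C1_boundary_def)
    note nontrivial = frontier_limit_points[OF \<rho> \<Omega>(1) x]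
    have "\<forall>\<^sub>F y in at x within \<Omega>. k = u y - s \<bullet> y"
      using k by (simp add: eventually_at_filter)
    then have "((\<lambda>x. u x - s \<bullet> x) \<longlongrightarrow> k) (at x within \<Omega>)" by (rule Lim_transform_eventually[OF tendsto_const])
    with um(1) have "um - s \<bullet> x = k" using nontrivial(1) tendsto_unique by blast
    then have "um = (\<sigma>m *v a) \<bullet> x / \<sigma>c + k" by (simp add: s_def)
    with um(2) show ?thesis by (simp add: algebra_simps)
  qed
  then show ?thesis by blast
qed

text \<open>
  The scalar relations for the coordinate directions are the components of
  \<open>\<sigma>m \<nu> = \<beta> (x - \<sigma>m x / \<sigma>c - k)\<close>; apply the inverse of \<open>\<sigma>m\<close>.
\<close>

lemma neutral_normal_field:
  fixes \<Omega> :: "(real^'d) set" and \<sigma>m :: "real^'d^'d"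
  assumes \<Omega>: "open \<Omega>" "connected \<Omega>" "bounded \<Omega>" "C1_boundary \<Omega>" and \<sigma>c: "0 < \<sigma>c"
    and \<sigma>m: "pos_def \<sigma>m" and neutral: "neutral_to_all \<Omega> \<sigma>c \<sigma>m \<beta>"
  shows "\<exists>b. \<forall>x\<in>frontier \<Omega>. outward_normal \<Omega> x
    = (\<beta> x / \<sigma>c) *\<^sub>R ((\<sigma>c *\<^sub>R matrix_inv \<sigma>m - mat 1) *v x - b)"
proof -
  define M where "M = matrix_inv \<sigma>m"
  have sym: "transpose \<sigma>m = \<sigma>m" by (rule pos_defD(1)[OF \<sigma>m])
  have "\<exists>k. \<forall>x\<in>frontier \<Omega>. \<beta> x * (axis i 1 \<bullet> x - (\<sigma>m *v axis i 1) \<bullet> x / \<sigma>c - k)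
      = outward_normal \<Omega> x \<bullet> (\<sigma>m *v axis i 1)" for i
    using neutral unfolding neutral_to_all_def
    by (intro neutral_boundary_relation[OF \<Omega> \<sigma>c]) (simp add: norm_axis_1)
  then obtain k where k: "\<And>i x. x \<in> frontier \<Omega> \<Longrightarrow>
      \<beta> x * (axis i 1 \<bullet> x - (\<sigma>m *v axis i 1) \<bullet> x / \<sigma>c - k i) = outward_normal \<Omega> x \<bullet> (\<sigma>m *v axis i 1)"
    by metis
  define kv :: "real^'d" where "kv = (\<chi> i. k i)"
  have "outward_normal \<Omega> x = (\<beta> x / \<sigma>c) *\<^sub>R ((\<sigma>c *\<^sub>R M - mat 1) *v x - \<sigma>c *\<^sub>R (M *v kv))"
    if x: "x \<in> frontier \<Omega>" for x
  proof -
    have comp: "(\<sigma>m *v axis i 1) \<bullet> y = (\<sigma>m *v y) $ i" for i y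
      using symmetric_matrix_inner[OF sym, of "axis i 1" y] by (simp add: inner_axis' inner_commute)
    have "\<sigma>m *v outward_normal \<Omega> x = \<beta> x *\<^sub>R (x - (1 / \<sigma>c) *\<^sub>R (\<sigma>m *v x) - kv)"
    proof (rule vec_eq_iff[THEN iffD2], rule allI)
      fix i
      show "(\<sigma>m *v outward_normal \<Omega> x) $ i = (\<beta> x *\<^sub>R (x - (1 / \<sigma>c) *\<^sub>R (\<sigma>m *v x) - kv)) $ i"
        using k[OF x, of i] comp[of i x] comp[of i "outward_normal \<Omega> x"]
        by (simp add: kv_def inner_axis inner_commute)
    qed
    then have "M *v (\<sigma>m *v outward_normal \<Omega> x) = M *v (\<beta> x *\<^sub>R (x - (1 / \<sigma>c) *\<^sub>R (\<sigma>m *v x) - kv))"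
      by simp
    then have "outward_normal \<Omega> x = \<beta> x *\<^sub>R (M *v x - (1 / \<sigma>c) *\<^sub>R x - M *v kv)"
      by (simp add: M_def pos_def_matrix_inv[OF \<sigma>m] matrix_vector_mult_scaleR matrix_vector_mult_diff_distrib)
    also have "\<dots> = (\<beta> x / \<sigma>c) *\<^sub>R ((\<sigma>c *\<^sub>R M - mat 1) *v x - \<sigma>c *\<^sub>R (M *v kv))"
      using \<sigma>c by (simp add: matrix_vector_mult_diff_rdistrib algebra_simps flip: scaleR_matrix_vector_assoc)
    finally show ?thesis .
  qed
  then show ?thesis unfolding M_def by blast
qed

text \<open>
  The matrix \<open>B\<close> is always positive semidefinite here. In particular no neutral inclusion exists
  when \<open>\<sigma>m - \<sigma>c I\<close> is positive definite, since then \<open>B\<close> is negative definite.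
\<close>

lemma neutral_centre:
  fixes \<Omega> :: "(real^'d) set" and \<sigma>m :: "real^'d^'d"
  assumes \<Omega>: "open \<Omega>" "connected \<Omega>" "bounded \<Omega>" "C1_boundary \<Omega>" "\<Omega> \<noteq> {}" and \<sigma>c: "0 < \<sigma>c"
    and \<sigma>m: "pos_def \<sigma>m" and neutral: "neutral_to_all \<Omega> \<sigma>c \<sigma>m \<beta>" and \<beta>: "interface_parameter \<Omega> \<beta>"
    and B: "B = \<sigma>c *\<^sub>R matrix_inv \<sigma>m - mat 1"
  shows "transpose B = B \<and> (\<forall>y. 0 \<le> y \<bullet> (B *v y)) \<and>
    (\<exists>c\<in>\<Omega>. \<forall>x\<in>frontier \<Omega>. \<exists>t\<ge>0. outward_normal \<Omega> x = t *\<^sub>R (B *v (x - c)))"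
proof -
  have sym: "transpose B = B"
    using pos_defD(1)[OF pos_def_matrix_inv(3)[OF \<sigma>m]]
    by (simp add: B transpose_diff_real transpose_scalar transpose_mat)
  obtain b where b: "\<And>x. x \<in> frontier \<Omega> \<Longrightarrow> outward_normal \<Omega> x = (\<beta> x / \<sigma>c) *\<^sub>R (B *v x - b)"
    using neutral_normal_field[OF \<Omega>(1-4) \<sigma>c \<sigma>m neutral] unfolding B by blast
  have nn: "\<beta> x / \<sigma>c \<ge> 0" if "x \<in> frontier \<Omega>" for x
    using \<beta> \<sigma>c that by (simp add: interface_parameter_def)
  have "\<exists>t\<ge>0. outward_normal \<Omega> x = t *\<^sub>R (B *v x - b)" if "x \<in> frontier \<Omega>" for x
    using b nn that by blast
  then obtain c where c: "c \<in> \<Omega>" "B *v c = b" "\<And>y. 0 \<le> y \<bullet> (B *v y)"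
    using affine_normal_field_centre[OF \<Omega>(1,3,5,4) sym] by blast
  have "\<exists>t\<ge>0. outward_normal \<Omega> x = t *\<^sub>R (B *v (x - c))" if "x \<in> frontier \<Omega>" for x
    using b nn that c(2) by (metis matrix_vector_mult_diff_distrib)
  with c sym show ?thesis by blast
qed

text \<open>
  The kernel consists of the \<open>y\<close> with \<open>\<sigma>m y = \<sigma>c y\<close>, where the form of
  \<open>\<sigma>m - \<sigma>c I\<close> vanishes.
\<close>

lemma definite_contrast_injective:
  assumes "pos_def \<sigma>m" "pos_def (\<sigma>m - mat \<sigma>c) \<or> neg_def (\<sigma>m - mat \<sigma>c)"
    and "(\<sigma>c *\<^sub>R matrix_inv \<sigma>m - mat 1) *v y = 0"
  shows "y = 0"
proof -
  have "\<sigma>c *\<^sub>R (matrix_inv \<sigma>m *v y) = y"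
    using assms(3) by (simp add: matrix_vector_mult_diff_rdistrib flip: scaleR_matrix_vector_assoc)
  then have "\<sigma>m *v (\<sigma>c *\<^sub>R (matrix_inv \<sigma>m *v y)) = \<sigma>m *v y" by simp
  then have "\<sigma>c *\<^sub>R y = \<sigma>m *v y"
    by (simp add: matrix_vector_mult_scaleR pos_def_matrix_inv[OF assms(1)])
  then have 0: "(\<sigma>m - mat \<sigma>c) *v y = 0"
    by (simp add: matrix_vector_mult_diff_rdistrib matrix_vector_mult_mat)
  then have "(- (\<sigma>m - mat \<sigma>c)) *v y = 0"
    using matrix_vector_mult_diff_rdistrib[of 0 "\<sigma>m - mat \<sigma>c" y] by simp
  with 0 show ?thesis using assms(2) pos_defD(4)[of _ y] unfolding neg_def_def by force
qed

lemma neutral_implies_ellipsoid: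
  fixes \<Omega> :: "(real^'d) set" and \<sigma>m :: "real^'d^'d"
  assumes dim: "CARD('d) \<ge> 2"
    and \<Omega>: "open \<Omega>" "connected \<Omega>" "bounded \<Omega>" "C1_boundary \<Omega>" "\<Omega> \<noteq> {}" and \<sigma>c: "0 < \<sigma>c"
    and \<sigma>m: "pos_def \<sigma>m" and neutral: "neutral_to_all \<Omega> \<sigma>c \<sigma>m \<beta>" and \<beta>: "interface_parameter \<Omega> \<beta>"
    and inj: "\<And>y. (\<sigma>c *\<^sub>R matrix_inv \<sigma>m - mat 1) *v y = 0 \<Longrightarrow> y = 0"
  obtains c r where "pos_def (\<sigma>c *\<^sub>R matrix_inv \<sigma>m - mat 1)" "0 < r"
    "\<Omega> = {x. (x - c) \<bullet> ((\<sigma>c *\<^sub>R matrix_inv \<sigma>m - mat 1) *v (x - c)) < r\<^sup>2}"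
proof -
  define B where "B = \<sigma>c *\<^sub>R matrix_inv \<sigma>m - mat 1"
  obtain c where c: "c \<in> \<Omega>" "transpose B = B" "\<And>y. 0 \<le> y \<bullet> (B *v y)"
    "\<And>x. x \<in> frontier \<Omega> \<Longrightarrow> \<exists>t\<ge>0. outward_normal \<Omega> x = t *\<^sub>R (B *v (x - c))"
    using neutral_centre[OF \<Omega> \<sigma>c \<sigma>m neutral \<beta> B_def] by blast
  have pd: "pos_def B" using nonneg_injective_pos_def[OF c(2,3)] inj unfolding B_def by blast
  obtain r where "r > 0" "\<Omega> = {x. (x - c) \<bullet> (B *v (x - c)) < r\<^sup>2}"
    using radial_normal_field_ellipsoid[OF dim \<Omega>(1-4) pd c(1,4)] by blast
  with pd that show ?thesis unfolding B_def by blast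
qed

text \<open>
  Here \<open>B\<close> is the scalar \<open>k = \<sigma>c / s - 1\<close>, which is non-negative. It is not zero, as the normal
  is a multiple of \<open>k (x - c)\<close> on the non-empty frontier.
\<close>

lemma isotropic_neutral_implies_ball:
  fixes \<Omega> :: "(real^'d) set"
  assumes dim: "CARD('d) \<ge> 2"
    and \<Omega>: "open \<Omega>" "connected \<Omega>" "bounded \<Omega>" "C1_boundary \<Omega>" "\<Omega> \<noteq> {}" and \<sigma>c: "0 < \<sigma>c" and s: "0 < s"
    and neutral: "neutral_to_all \<Omega> \<sigma>c (mat s) \<beta>" and \<beta>: "interface_parameter \<Omega> \<beta>"
  shows "\<exists>c r. 0 < r \<and> \<Omega> = ball c r"
proof -
  define k where "k = \<sigma>c / s - 1"
  have pd: "pos_def (mat s :: real^'d^'d)"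
    using s by (simp add: pos_def_def transpose_mat matrix_vector_mult_mat)
  have "matrix_inv (mat s :: real^'d^'d) = mat (1 / s)"
    using s by (intro matrix_inv_unique) (auto simp: matrix_eq matrix_vector_mult_mat simp flip: matrix_vector_mul_assoc)
  then have B: "(\<sigma>c *\<^sub>R matrix_inv (mat s) - mat 1) *v x = k *\<^sub>R x" for x :: "real^'d"
    by (simp add: matrix_vector_mult_diff_rdistrib matrix_vector_mult_mat k_def scaleR_left_diff_distrib
        flip: scaleR_matrix_vector_assoc)
  obtain c where c: "\<And>y::real^'d. 0 \<le> y \<bullet> (k *\<^sub>R y)"
    "\<And>x. x \<in> frontier \<Omega> \<Longrightarrow> \<exists>t\<ge>0. outward_normal \<Omega> x = t *\<^sub>R (k *\<^sub>R (x - c))"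
    using neutral_centre[OF \<Omega> \<sigma>c pd neutral \<beta> refl] unfolding B by blast
  have "k \<noteq> 0"
  proof
    assume "k = 0"
    have "\<Omega> \<noteq> UNIV" using \<Omega>(3) not_bounded_UNIV by metis
    then obtain p where p: "p \<in> frontier \<Omega>" using frontier_not_empty[OF \<Omega>(5)] by blast
    then obtain U \<rho> where \<rho>: "C1_defining_function \<Omega> p U \<rho>" using \<Omega>(4) by (auto simp: C1_boundary_def)
    have "outward_normal \<Omega> p \<noteq> 0"
      using outward_normal_eq[OF \<rho> \<Omega>(1) p] C1_defining_functionD(2,4)[OF \<rho>] by simp
    then show False using c(2)[OF p] \<open>k = 0\<close> by auto
  qed
  moreover obtain e :: "real^'d" where "norm e = 1" using vector_choose_size[of 1] by auto
  ultimately have "k > 0" using c(1)[of e] by (simp add: dot_square_norm)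
  have inj: "y = 0" if "(\<sigma>c *\<^sub>R matrix_inv (mat s) - mat 1) *v y = 0" for y :: "real^'d"
    using that \<open>k \<noteq> 0\<close> by (simp add: B)
  obtain c' r where r: "0 < r" "\<Omega> = {x. (x - c') \<bullet> (k *\<^sub>R (x - c')) < r\<^sup>2}"
    by (rule neutral_implies_ellipsoid[OF dim \<Omega> \<sigma>c pd neutral \<beta> inj]) (simp_all add: B)
  have "(x - c') \<bullet> (k *\<^sub>R (x - c')) < r\<^sup>2 \<longleftrightarrow> x \<in> ball c' (r / sqrt k)" for x
  proof -
    have "(x - c') \<bullet> (k *\<^sub>R (x - c')) = (sqrt k * norm (x - c'))\<^sup>2"
      using \<open>k > 0\<close> by (simp add: dot_square_norm power_mult_distrib)
    also have "\<dots> < r\<^sup>2 \<longleftrightarrow> sqrt k * norm (x - c') < r"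
      using r(1) \<open>k > 0\<close> power_strict_mono[of "sqrt k * norm (x - c')" r 2]
        power_less_imp_less_base[of "sqrt k * norm (x - c')" 2 r] by auto
    also have "\<dots> \<longleftrightarrow> x \<in> ball c' (r / sqrt k)"
      using \<open>k > 0\<close> by (simp add: dist_norm norm_minus_commute field_simps)
    finally show ?thesis .
  qed
  then have "\<Omega> = ball c' (r / sqrt k)" using r(2) by blast
  moreover have "r / sqrt k > 0" using r(1) \<open>k > 0\<close> by simp
  ultimately show ?thesis by blast
qed

section \<open>Compatible ellipsoids are neutral\<close>

lemma ellipsoid_outward_normal:
  fixes \<Omega> :: "(real^'d) set"
  assumes \<Omega>: "open \<Omega>" and B: "pos_def B" and E: "\<Omega> = {x. (x - c) \<bullet> (B *v (x - c)) < r\<^sup>2}" and r: "0 < r"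
    and p: "p \<in> frontier \<Omega>"
  shows "p \<noteq> c" "outward_normal \<Omega> p = (B *v (p - c)) /\<^sub>R norm (B *v (p - c))"
proof -
  have "c \<in> \<Omega>" using r by (simp add: E)
  then show pc: "p \<noteq> c" using p \<Omega> by (auto simp: frontier_def interior_open)
  define \<rho> where "\<rho> x = (x - c) \<bullet> (B *v (x - c)) - r\<^sup>2" for x
  have der: "(\<rho> has_derivative (\<lambda>h. (2 *\<^sub>R (B *v (x - c))) \<bullet> h)) (at x)" for x
    using has_derivative_diff[OF has_derivative_quadratic_form[OF pos_defD(1)[OF B], of c x] has_derivative_const[of "r\<^sup>2"]]
    by (simp add: \<rho>_def[abs_def])
  have g: "grad \<rho> x = 2 *\<^sub>R (B *v (x - c))" for x by (rule grad_unique[OF der])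
  have "B *v (x - c) \<noteq> 0" if "x \<noteq> c" for x using pos_defD(2)[OF B, of "x - c"] that by auto
  moreover have "continuous_on (- {c}) (grad \<rho>)"
    unfolding g[abs_def]
    by (intro continuous_intros linear_continuous_on_compose[OF _ matrix_vector_mul_linear])
  ultimately have "C1_defining_function \<Omega> p (- {c}) \<rho>"
    unfolding C1_defining_function_def using der pc
    by (auto simp: g differentiable_def E \<rho>_def open_Compl)
  from outward_normal_eq[OF this \<Omega> p] show "outward_normal \<Omega> p = (B *v (p - c)) /\<^sub>R norm (B *v (p - c))"
    by (simp add: g)
qed

text \<open>
  The solution equals \<open>a \<bullet> x\<close> outside and inside has the gradient \<open>(\<sigma>m *v a) / \<sigma>c\<close>
  that gives the right flux; its additive constant makes the two agree at the centre. The jump at \<open>x\<close> is then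
  \<open>a \<bullet> \<sigma>m B (x - c) / \<sigma>c\<close>, because \<open>\<sigma>m B = \<sigma>c I - \<sigma>m\<close>.
\<close>

lemma ellipsoid_neutral_solution:
  fixes \<Omega> :: "(real^'d) set" and \<sigma>m :: "real^'d^'d"
  assumes \<Omega>: "open \<Omega>" "bounded \<Omega>" and \<sigma>c: "0 < \<sigma>c" and \<sigma>m: "pos_def \<sigma>m"
    and B: "B = \<sigma>c *\<^sub>R matrix_inv \<sigma>m - mat 1" "pos_def B"
    and E: "\<Omega> = {x. (x - c) \<bullet> (B *v (x - c)) < r\<^sup>2}" and r: "0 < r"
  shows "neutral_to \<Omega> \<sigma>c \<sigma>m (\<lambda>x. \<sigma>c / norm (B *v (x - c))) a"
proof -
  define s where "s = (1 / \<sigma>c) *\<^sub>R (\<sigma>m *v a)"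
  define u where "u x = (if x \<in> \<Omega> then s \<bullet> x + (a \<bullet> c - s \<bullet> c) else a \<bullet> x)" for x
  have u_in: "u x = s \<bullet> x + (a \<bullet> c - s \<bullet> c)" if "x \<in> \<Omega>" for x using that by (simp add: u_def)
  have u_out: "u x = a \<bullet> x + 0" if "x \<in> - closure \<Omega>" for x
    using that closure_subset[of \<Omega>] by (auto simp: u_def)
  have oC: "open (- closure \<Omega>)" by (rule open_Compl[OF closed_closure])
  have inside: "u differentiable (at x)" "grad u x = s" "(grad u has_derivative (\<lambda>_. 0)) (at x)"
    if "x \<in> \<Omega>" for x
    using affine_grad[OF \<Omega>(1) u_in that] by auto
  have outside: "u differentiable (at x)" "grad u x = a" "(grad u has_derivative (\<lambda>_. 0)) (at x)"
    if "x \<in> - closure \<Omega>" for x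
    using affine_grad[OF oC u_out that] by auto
  have Hess: "jacobian (grad u) (at x) = 0" if "x \<in> \<Omega> \<union> - closure \<Omega>" for x
  proof -
    have "(grad u has_derivative (\<lambda>_. 0)) (at x)" using inside(3) outside(3) that by blast
    then have "frechet_derivative (grad u) (at x) = (\<lambda>_. 0)" by (metis frechet_derivative_at)
    then show ?thesis by (simp add: jacobian_def matrix_def vec_eq_iff)
  qed
  have C2: "C2_on (\<Omega> \<union> - closure \<Omega>) u"
    unfolding C2_on_def
  proof (intro conjI ballI)
    fix x assume "x \<in> \<Omega> \<union> - closure \<Omega>"
    then show "u differentiable (at x)" "grad u differentiable (at x)"
      using inside(1,3) outside(1,3) unfolding differentiable_def[of "grad u"] by blast+
  next
    show "continuous_on (\<Omega> \<union> - closure \<Omega>) (\<lambda>x. jacobian (grad u) (at x))"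
      by (rule continuous_on_eq[of _ "\<lambda>_. 0"]) (auto simp: Hess)
  qed
  have div: "divergence (\<lambda>y. conductivity \<Omega> \<sigma>c \<sigma>m y *v grad u y) x = 0" if x: "x \<in> \<Omega> \<union> - closure \<Omega>" for x
  proof -
    have "((\<lambda>y. conductivity \<Omega> \<sigma>c \<sigma>m y *v grad u y) has_derivative (\<lambda>_. 0)) (at x)"
    proof (cases "x \<in> \<Omega>")
      case True
      show ?thesis
        by (rule has_derivative_transform_within_open[OF has_derivative_const[of "mat \<sigma>c *v s"] \<Omega>(1) True])
          (simp add: conductivity_cases[OF \<Omega>(1)] inside(2))
    next
      case False
      then have x': "x \<in> - closure \<Omega>" using x by blast
      have "\<sigma>m *v a = conductivity \<Omega> \<sigma>c \<sigma>m y *v grad u y" if "y \<in> - closure \<Omega>" for y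
        using conductivity_cases(2)[OF \<Omega>(1) that] outside(2)[OF that] by simp
      from has_derivative_transform_within_open[OF has_derivative_const oC x' this]
      show ?thesis .
    qed
    then have "frechet_derivative (\<lambda>y. conductivity \<Omega> \<sigma>c \<sigma>m y *v grad u y) (at x) = (\<lambda>_. 0)"
      by (metis frechet_derivative_at)
    then show ?thesis by (simp add: divergence_def jacobian_def trace_def matrix_def)
  qed
  have lim: "(f \<longlongrightarrow> l) (at x within S)" if "(g \<longlongrightarrow> l) (at x within S)" "\<And>y. y \<in> S \<Longrightarrow> f y = g y"
    for f g :: "real^'d \<Rightarrow> 'b::topological_space" and l x S
    using that(1) by (rule Lim_transform_eventually) (auto simp: eventually_at_filter that(2))
  have interface: "\<exists>up um gp gm.
      (u \<longlongrightarrow> up) (at x within - closure \<Omega>) \<and> (u \<longlongrightarrow> um) (at x within \<Omega>) \<and>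
      (grad u \<longlongrightarrow> gp) (at x within - closure \<Omega>) \<and> (grad u \<longlongrightarrow> gm) (at x within \<Omega>) \<and>
      \<sigma>c / norm (B *v (x - c)) * (up - um) = outward_normal \<Omega> x \<bullet> (\<sigma>m *v gp) \<and>
      \<sigma>c * (outward_normal \<Omega> x \<bullet> gm) = outward_normal \<Omega> x \<bullet> (\<sigma>m *v gp)" if x: "x \<in> frontier \<Omega>" for x
  proof (intro exI conjI)
    show "(u \<longlongrightarrow> a \<bullet> x) (at x within - closure \<Omega>)"
      by (rule lim[of "\<lambda>y. a \<bullet> y"]) (auto simp: u_out intro!: tendsto_intros)
    show "(u \<longlongrightarrow> s \<bullet> x + (a \<bullet> c - s \<bullet> c)) (at x within \<Omega>)"
      by (rule lim[of "\<lambda>y. s \<bullet> y + (a \<bullet> c - s \<bullet> c)"]) (auto simp: u_in intro!: tendsto_intros)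
    show "(grad u \<longlongrightarrow> a) (at x within - closure \<Omega>)"
      by (rule lim[of "\<lambda>_. a"]) (auto simp: outside(2))
    show "(grad u \<longlongrightarrow> s) (at x within \<Omega>)"
      by (rule lim[of "\<lambda>_. s"]) (auto simp: inside(2))
    show "\<sigma>c * (outward_normal \<Omega> x \<bullet> s) = outward_normal \<Omega> x \<bullet> (\<sigma>m *v a)"
      using \<sigma>c by (simp add: s_def)
    define y where "y = x - c"
    note n = ellipsoid_outward_normal[OF \<Omega>(1) B(2) E r x, folded y_def]
    have sym: "transpose \<sigma>m = \<sigma>m" by (rule pos_defD(1)[OF \<sigma>m])
    have "\<sigma>m *v (B *v y) = \<sigma>c *\<^sub>R y - \<sigma>m *v y"
      by (simp add: B(1) matrix_vector_mult_diff_rdistrib matrix_vector_mult_diff_distrib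
          matrix_vector_mult_scaleR pos_def_matrix_inv[OF \<sigma>m] flip: scaleR_matrix_vector_assoc)
    then have "(B *v y) \<bullet> (\<sigma>m *v a) = (\<sigma>c *\<^sub>R y - \<sigma>m *v y) \<bullet> a"
      by (metis symmetric_matrix_inner[OF sym])
    also have "\<dots> = \<sigma>c * (a \<bullet> x - (s \<bullet> x + (a \<bullet> c - s \<bullet> c)))"
      using \<sigma>c symmetric_matrix_inner[OF sym, of y a]
      by (simp add: s_def y_def inner_diff_left inner_diff_right inner_commute algebra_simps)
    finally show "\<sigma>c / norm (B *v (x - c)) * (a \<bullet> x - (s \<bullet> x + (a \<bullet> c - s \<bullet> c)))
        = outward_normal \<Omega> x \<bullet> (\<sigma>m *v a)"
      unfolding n(2) by (simp add: y_def divide_inverse mult_ac)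
  qed
  obtain R where R: "\<And>x. x \<in> \<Omega> \<Longrightarrow> norm x \<le> R" using \<Omega>(2) by (auto simp: bounded_iff)
  have "\<forall>\<^sub>F x in at_infinity. norm (u x - a \<bullet> x) \<le> 0 * norm (norm x powr (1 - real CARD('d)))"
    unfolding eventually_at_infinity
  proof (intro exI allI impI)
    fix x :: "real^'d" assume "R + 1 \<le> norm x"
    then have "x \<notin> \<Omega>" using R[of x] by force
    then show "norm (u x - a \<bullet> x) \<le> 0 * norm (norm x powr (1 - real CARD('d)))" by (simp add: u_def)
  qed
  then have "(\<lambda>x. u x - a \<bullet> x) \<in> O[at_infinity](\<lambda>x. norm x powr (1 - real CARD('d)))" by (rule bigoI)
  with C2 div interface have "imperfect_interface_solution \<Omega> \<sigma>c \<sigma>m (\<lambda>x. \<sigma>c / norm (B *v (x - c))) a u"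
    unfolding imperfect_interface_solution_def by blast
  moreover have "\<forall>x\<in>- \<Omega>. u x - a \<bullet> x = 0" by (simp add: u_def)
  ultimately show ?thesis unfolding neutral_to_def by blast
qed

text \<open>
  Boundedness of \<open>\<Omega>\<close> is what makes the matrix of the ellipsoid positive definite.
\<close>

lemma axes_compatible_implies_neutral:
  fixes \<Omega> :: "(real^'d) set" and \<sigma>m :: "real^'d^'d"
  assumes \<Omega>: "open \<Omega>" "bounded \<Omega>" and \<sigma>c: "0 < \<sigma>c" and \<sigma>m: "pos_def \<sigma>m"
    and E: "axes_compatible \<sigma>c \<sigma>m \<Omega>"
  shows "\<exists>\<beta>. interface_parameter \<Omega> \<beta> \<and> neutral_to_all \<Omega> \<sigma>c \<sigma>m \<beta>"
proof -
  define B where "B = \<sigma>c *\<^sub>R matrix_inv \<sigma>m - mat 1"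
  obtain c r where r: "0 < r" "\<Omega> = {x. (x - c) \<bullet> (B *v (x - c)) < r\<^sup>2}"
    using E unfolding axes_compatible_def B_def by blast
  have "transpose B = B"
    using pos_defD(1)[OF pos_def_matrix_inv(3)[OF \<sigma>m]]
    by (simp add: B_def transpose_diff_real transpose_scalar transpose_mat)
  then have pd: "pos_def B"
    by (rule bounded_ellipsoid_pos_def[OF _ \<Omega>(2)[unfolded r(2)] r(1)])
  have "neutral_to_all \<Omega> \<sigma>c \<sigma>m (\<lambda>x. \<sigma>c / norm (B *v (x - c)))"
    unfolding neutral_to_all_def using ellipsoid_neutral_solution[OF \<Omega> \<sigma>c \<sigma>m B_def pd r(2,1)] by blast
  moreover have "interface_parameter \<Omega> (\<lambda>x. \<sigma>c / norm (B *v (x - c)))"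
    using \<sigma>c by (simp add: interface_parameter_def)
  ultimately show ?thesis by blast
qed

text \<open>
  The equation \<open>\<sigma>c \<sigma>m\<inverse> - I = Q\<close> has the solution \<open>\<sigma>m = \<sigma>c (I + Q)\<inverse>\<close>.
\<close>

lemma ellipsoid_compatible_conductivity:
  fixes Q :: "real^'d^'d"
  assumes Q: "pos_def Q" and \<sigma>c: "0 < \<sigma>c"
  obtains \<sigma>m where "pos_def \<sigma>m" "neg_def (\<sigma>m - mat \<sigma>c)" "\<sigma>c *\<^sub>R matrix_inv \<sigma>m - mat 1 = Q"
proof -
  define P where "P = mat 1 + Q"
  define M where "M = matrix_inv P"
  have Pv: "P *v y = y + Q *v y" for y by (simp add: P_def matrix_vector_mult_add_rdistrib)
  have P: "pos_def P"
    unfolding pos_def_def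
  proof (intro conjI allI impI)
    show "transpose P = P" by (simp add: P_def transpose_add_real transpose_mat pos_defD(1)[OF Q])
    fix x :: "real^'d" assume "x \<noteq> 0"
    then show "0 < x \<bullet> (P *v x)"
      using pos_defD(2)[OF Q, of x] by (simp add: Pv inner_add_right add_pos_pos)
  qed
  note M = pos_def_matrix_inv[OF P, folded M_def]
  have Mv: "(\<sigma>c *\<^sub>R M) *v x = \<sigma>c *\<^sub>R (M *v x)" for x by (simp add: scaleR_matrix_vector_assoc)
  have 1: "pos_def (\<sigma>c *\<^sub>R M)"
    using M(3) \<sigma>c by (auto simp: pos_def_def Mv transpose_scalar)
  have "matrix_inv (\<sigma>c *\<^sub>R M) = (1 / \<sigma>c) *\<^sub>R P"
    using \<sigma>c M(1,2) by (intro matrix_inv_unique) (auto simp: matrix_scalar_ac scalar_matrix_assoc simp flip: scalar_matrix_assoc)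
  then have 2: "\<sigma>c *\<^sub>R matrix_inv (\<sigma>c *\<^sub>R M) - mat 1 = Q" using \<sigma>c by (simp add: P_def)
  have "pos_def (- (\<sigma>c *\<^sub>R M - mat \<sigma>c))"
    unfolding pos_def_def
  proof (intro conjI allI impI)
    show "transpose (- (\<sigma>c *\<^sub>R M - mat \<sigma>c)) = - (\<sigma>c *\<^sub>R M - mat \<sigma>c)"
      by (simp add: transpose_diff_real transpose_scalar transpose_mat pos_defD(1)[OF M(3)])
    fix x :: "real^'d" assume x: "x \<noteq> 0"
    \<comment> \<open>With \<open>x = (I + Q) y\<close> the form of \<open>\<sigma>c I - \<sigma>m\<close> at \<open>x\<close> is \<open>\<sigma>c (y \<bullet> Q y + |Q y|\<^sup>2)\<close>.\<close>
    define y where "y = M *v x"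
    have xy: "x = P *v y" using M(4) by (simp add: y_def)
    have y0: "y \<noteq> 0" using x xy by auto
    have "(- (\<sigma>c *\<^sub>R M - mat \<sigma>c)) *v x = \<sigma>c *\<^sub>R (x - y)"
      by (simp add: matrix_vector_mult_diff_rdistrib matrix_vector_mult_mat Mv y_def algebra_simps)
    also have "x - y = Q *v y" by (simp add: xy Pv)
    finally have "x \<bullet> ((- (\<sigma>c *\<^sub>R M - mat \<sigma>c)) *v x) = \<sigma>c * (x \<bullet> (Q *v y))" by simp
    also have "x \<bullet> (Q *v y) = y \<bullet> (Q *v y) + (Q *v y) \<bullet> (Q *v y)"
      by (simp add: xy Pv inner_add_left)
    finally show "0 < x \<bullet> ((- (\<sigma>c *\<^sub>R M - mat \<sigma>c)) *v x)"
      using \<sigma>c pos_defD(2)[OF Q y0] by (simp add: add_pos_nonneg)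
  qed
  with 1 2 that show ?thesis by (simp add: neg_def_def)
qed

lemma is_ellipsoidI:
  assumes "pos_def B" "0 < r" "E = {x. (x - c) \<bullet> (B *v (x - c)) < r\<^sup>2}"
  shows "is_ellipsoid E"
proof -
  define Q where "Q = (1 / r\<^sup>2) *\<^sub>R B"
  have Qv: "Q *v x = (1 / r\<^sup>2) *\<^sub>R (B *v x)" for x by (simp add: Q_def scaleR_matrix_vector_assoc)
  have "pos_def Q" using assms(1,2) by (auto simp: pos_def_def Qv) (simp add: Q_def transpose_scalar)
  moreover have "E = {x. (x - c) \<bullet> (Q *v (x - c)) < 1}"
    using assms(2,3) by (simp add: Qv field_simps)
  ultimately show ?thesis unfolding is_ellipsoid_def by blast
qed

section \<open>Characterisation of neutral inclusions\<close>

theorem theorem6p1: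
  fixes \<Omega> :: "(real^'d) set" and \<sigma>c :: real
  assumes "CARD('d) = 2 \<or> CARD('d) = 3"
    and "open \<Omega>" and "connected \<Omega>" and "\<Omega> \<noteq> {}"
    and "bounded \<Omega>" and "simply_connected \<Omega>" and "C1_boundary \<Omega>"
    and "0 < \<sigma>c"
  shows
    "((\<exists>\<sigma>m. pos_def \<sigma>m \<and> (pos_def (\<sigma>m - mat \<sigma>c) \<or> neg_def (\<sigma>m - mat \<sigma>c)) \<and>
         (\<exists>\<beta>. interface_parameter \<Omega> \<beta> \<and> neutral_to_all \<Omega> \<sigma>c \<sigma>m \<beta>))
       \<longleftrightarrow> is_ellipsoid \<Omega>) \<and>
     (\<forall>\<sigma>m. pos_def \<sigma>m \<and> (pos_def (\<sigma>m - mat \<sigma>c) \<or> neg_def (\<sigma>m - mat \<sigma>c)) \<longrightarrow>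
         ((\<exists>\<beta>. interface_parameter \<Omega> \<beta> \<and> neutral_to_all \<Omega> \<sigma>c \<sigma>m \<beta>)
           \<longleftrightarrow> is_ellipsoid \<Omega> \<and> axes_compatible \<sigma>c \<sigma>m \<Omega>)) \<and>
     (\<forall>s>0. \<forall>\<beta>. interface_parameter \<Omega> \<beta> \<and> neutral_to_all \<Omega> \<sigma>c (mat s) \<beta> \<longrightarrow>
         (\<exists>c r. 0 < r \<and> \<Omega> = ball c r))"
proof -
  have dim: "CARD('d) \<ge> 2" using assms(1) by auto
  note \<Omega> = assms(2,3,5,7,4) and \<sigma>c = assms(8)
  have forward: "is_ellipsoid \<Omega> \<and> axes_compatible \<sigma>c \<sigma>m \<Omega>"
    if \<sigma>m: "pos_def \<sigma>m" "pos_def (\<sigma>m - mat \<sigma>c) \<or> neg_def (\<sigma>m - mat \<sigma>c)"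
      and \<beta>: "interface_parameter \<Omega> \<beta>" "neutral_to_all \<Omega> \<sigma>c \<sigma>m \<beta>" for \<sigma>m \<beta>
  proof -
    obtain c r where "pos_def (\<sigma>c *\<^sub>R matrix_inv \<sigma>m - mat 1)" "0 < r"
      "\<Omega> = {x. (x - c) \<bullet> ((\<sigma>c *\<^sub>R matrix_inv \<sigma>m - mat 1) *v (x - c)) < r\<^sup>2}"
      by (rule neutral_implies_ellipsoid[OF dim \<Omega> \<sigma>c \<sigma>m(1) \<beta>(2,1) definite_contrast_injective[OF \<sigma>m]])
    then show ?thesis using is_ellipsoidI unfolding axes_compatible_def by blast
  qed
  have second: "(\<exists>\<beta>. interface_parameter \<Omega> \<beta> \<and> neutral_to_all \<Omega> \<sigma>c \<sigma>m \<beta>)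
      \<longleftrightarrow> is_ellipsoid \<Omega> \<and> axes_compatible \<sigma>c \<sigma>m \<Omega>"
    if \<sigma>m: "pos_def \<sigma>m" "pos_def (\<sigma>m - mat \<sigma>c) \<or> neg_def (\<sigma>m - mat \<sigma>c)" for \<sigma>m
    using forward[OF \<sigma>m] axes_compatible_implies_neutral[OF \<Omega>(1,3) \<sigma>c \<sigma>m(1)] by blast
  have "\<exists>\<sigma>m. pos_def \<sigma>m \<and> (pos_def (\<sigma>m - mat \<sigma>c) \<or> neg_def (\<sigma>m - mat \<sigma>c)) \<and>
         (\<exists>\<beta>. interface_parameter \<Omega> \<beta> \<and> neutral_to_all \<Omega> \<sigma>c \<sigma>m \<beta>)" if ell: "is_ellipsoid \<Omega>"
  proof -
    obtain c Q where Q: "pos_def Q" "\<Omega> = {x. (x - c) \<bullet> (Q *v (x - c)) < 1}"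
      using ell by (auto simp: is_ellipsoid_def)
    obtain \<sigma>m where \<sigma>m: "pos_def \<sigma>m" "neg_def (\<sigma>m - mat \<sigma>c)" "\<sigma>c *\<^sub>R matrix_inv \<sigma>m - mat 1 = Q"
      by (rule ellipsoid_compatible_conductivity[OF Q(1) \<sigma>c])
    have "axes_compatible \<sigma>c \<sigma>m \<Omega>"
      unfolding axes_compatible_def \<sigma>m(3) using Q(2) by (intro exI[of _ c] exI[of _ 1]) simp
    then show ?thesis using second[of \<sigma>m] \<sigma>m(1,2) ell by blast
  qed
  moreover have "\<exists>c r. 0 < r \<and> \<Omega> = ball c r"
    if "0 < s" "interface_parameter \<Omega> \<beta>" "neutral_to_all \<Omega> \<sigma>c (mat s) \<beta>" for s \<beta>
    by (rule isotropic_neutral_implies_ball[OF dim \<Omega> \<sigma>c that(1,3,2)])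
  ultimately show ?thesis using second forward by blast
qed

end
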